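(* For any positive integer $n$, $$\sum_{w\in \bar{B}_{n}^{FC}}q^{\mathrm{maj}(w)}=\sum_{h=1}^n q^h\sum_{i=0}^{h-1}\begin{bmatrix} h-1\\ i\end{bmatrix}_q+\begin{bmatrix} n\\ \lfloor n/2\rfloor\end{bmatrix}_q .$$
   Context: $B_n$ denotes the Coxeter group with generators $s_1,\dots,s_n$ and linear Coxeter graph $s_1 - s_2 - \cdots - s_{n-1} - s_n$ in which $m_{s_is_{i+1}}=3$ for $1\le i\le n-2$, $m_{s_{n-1}s_n}=4$, and all other pairs of distinct generators commute ($B_1$ has the single generator $s_1$). For a Coxeter system $(W,S)$ with length function $\ell$, an element $w\in W$ is fully commutative (FC) if any reduced expression of $w$ can be obtained from any other one by using only commutation relations $st=ts$ (for pairs with $m_{st}=2$). An involution is an element with $w^2=1$ (the identity included). $\bar{B}_n^{FC}$ is the set of fully commutative involutions of $B_n$. The right descent set is $\mathrm{Des}_R(w)=\{s\in S:\ell(ws)<\ell(w)\}$, and the major index is $\mathrm{maj}(w)=\sum_{s_i\in \mathrm{Des}_R(w)} i$ (with the generators of $B_n$ indexed $s_1,\dots,s_n$ along the linear Coxeter graph $s_1 - s_2 - \cdots - s_n$, so that the edge with $m_{st}=4$ is $\{s_{n-1},s_n\}$). For $0\le k\le n$, $\begin{bmatrix} n\\ k\end{bmatrix}_q=\dfrac{(1-q)\cdots(1-q^n)}{(1-q)\cdots(1-q^k)\,(1-q)\cdots(1-q^{n-k})}$ is the $q$-binomial coefficient. *)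

theory Defs
  imports
    "HOL-Algebra.Group"
    "HOL-Computational_Algebra.Polynomial"
    "HOL-Computational_Algebra.Fraction_Field"
begin

section \<open>Coxeter groups\<close>

text \<open>
  A Coxeter matrix is a function \<open>m :: 'a \<Rightarrow> 'a \<Rightarrow> nat\<close> on an index set \<open>I\<close> of generators,
  symmetric, with \<open>m s s = 1\<close> and \<open>m s t \<noteq> 1\<close> for \<open>s \<noteq> t\<close>; the value \<open>0\<close> stands for infinity
  (its relator is then the empty word).  The Coxeter group is
  \<open>\<langle> s \<in> I | (s t)^(m s t) = 1 \<rangle>\<close>.  As \<open>m s s = 1\<close> makes every generator its own inverse,
  this is the quotient of the free monoid \<open>lists I\<close> by the congruence generated by the relators.
\<close>

inductive cox_eq :: "'a set \<Rightarrow> ('a \<Rightarrow> 'a \<Rightarrow> nat) \<Rightarrow> 'a list \<Rightarrow> 'a list \<Rightarrow> bool"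
  for I :: "'a set" and m :: "'a \<Rightarrow> 'a \<Rightarrow> nat" where
  relator: "\<lbrakk>u \<in> lists I; v \<in> lists I; s \<in> I; t \<in> I\<rbrakk>
    \<Longrightarrow> cox_eq I m (u @ concat (replicate (m s t) [s, t]) @ v) (u @ v)"
| refl: "u \<in> lists I \<Longrightarrow> cox_eq I m u u"
| sym: "cox_eq I m u v \<Longrightarrow> cox_eq I m v u"
| trans: "\<lbrakk>cox_eq I m u v; cox_eq I m v w\<rbrakk> \<Longrightarrow> cox_eq I m u w"

definition cox_class :: "'a set \<Rightarrow> ('a \<Rightarrow> 'a \<Rightarrow> nat) \<Rightarrow> 'a list \<Rightarrow> 'a list set" where
  "cox_class I m u = {v. cox_eq I m u v}"

definition coxeter_group :: "'a set \<Rightarrow> ('a \<Rightarrow> 'a \<Rightarrow> nat) \<Rightarrow> 'a list set monoid" where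
  "coxeter_group I m =
    \<lparr>carrier = cox_class I m ` lists I,
     monoid.mult = (\<lambda>x y. {w. \<exists>u\<in>x. \<exists>v\<in>y. cox_eq I m (u @ v) w}),
     monoid.one = cox_class I m []\<rparr>"

definition cox_gen :: "'a set \<Rightarrow> ('a \<Rightarrow> 'a \<Rightarrow> nat) \<Rightarrow> 'a \<Rightarrow> 'a list set" where
  "cox_gen I m s = cox_class I m [s]"

lemma cox_eq_lists:
  assumes "cox_eq I m u v"
  shows "u \<in> lists I \<and> v \<in> lists I"
proof -
  have "set (concat (replicate k [s, t])) \<subseteq> I" if "s \<in> I" "t \<in> I" for s t k
    using that by (induction k) auto
  with assms show ?thesis
    by (induction rule: cox_eq.induct) (auto simp: in_lists_conv_set)
qed

lemma cox_eq_ctxt: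
  assumes "cox_eq I m u v" "a \<in> lists I" "b \<in> lists I"
  shows "cox_eq I m (a @ u @ b) (a @ v @ b)"
  using assms
proof (induction rule: cox_eq.induct)
  case (relator u v s t)
  then show ?case using cox_eq.relator[of "a @ u" I "v @ b" s t m] by simp
next
  case (refl u) then show ?case by (intro cox_eq.refl) simp
next
  case sym then show ?case by (blast intro: cox_eq.sym)
next
  case trans then show ?case by (blast intro: cox_eq.trans)
qed

lemma cox_eq_append:
  assumes "cox_eq I m u u'" "cox_eq I m v v'"
  shows "cox_eq I m (u @ v) (u' @ v')"
  using cox_eq_ctxt[OF assms(1), of "[]" v] cox_eq_ctxt[OF assms(2), of u' "[]"]
    cox_eq_lists[OF assms(1)] cox_eq_lists[OF assms(2)]
  by (auto intro: cox_eq.trans)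

lemma cox_class_eq_iff:
  assumes "u \<in> lists I"
  shows "cox_class I m u = cox_class I m v \<longleftrightarrow> cox_eq I m u v"
  using assms unfolding cox_class_def
  by (auto intro: cox_eq.refl cox_eq.sym cox_eq.trans)

lemma cox_mult_class:
  assumes "u \<in> lists I" "v \<in> lists I"
  shows "cox_class I m u \<otimes>\<^bsub>coxeter_group I m\<^esub> cox_class I m v = cox_class I m (u @ v)"
  using assms unfolding coxeter_group_def cox_class_def
  by (auto intro: cox_eq.refl cox_eq.trans cox_eq_append)

lemma cox_eq_rev:
  assumes "\<And>s. s \<in> I \<Longrightarrow> m s s = 1" "u \<in> lists I"
  shows "cox_eq I m (rev u @ u) []"
  using assms(2)
proof (induction u)
  case Nil show ?case by (auto intro: cox_eq.refl)
next
  case (Cons s u)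
  then have "cox_eq I m (rev u @ [s, s] @ u) (rev u @ u)"
    using cox_eq.relator[of "rev u" I u s s m] assms(1)[of s] by (auto simp: in_lists_conv_set)
  with Cons show ?case by (auto intro: cox_eq.trans)
qed

lemma group_coxeter_group:
  assumes "\<And>s. s \<in> I \<Longrightarrow> m s s = 1"
  shows "group (coxeter_group I m)"
proof (rule groupI)
  let ?G = "coxeter_group I m"
  have car: "carrier ?G = cox_class I m ` lists I" and one: "\<one>\<^bsub>?G\<^esub> = cox_class I m []"
    by (simp_all add: coxeter_group_def)
  show "\<one>\<^bsub>?G\<^esub> \<in> carrier ?G" by (auto simp: car one)
  fix x assume "x \<in> carrier ?G"
  then obtain u where u: "x = cox_class I m u" "u \<in> lists I" by (auto simp: car)
  show "\<one>\<^bsub>?G\<^esub> \<otimes>\<^bsub>?G\<^esub> x = x" using u by (simp add: one cox_mult_class)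
  have "cox_class I m (rev u) \<otimes>\<^bsub>?G\<^esub> x = \<one>\<^bsub>?G\<^esub>"
    using u cox_eq_rev[of I m u, OF assms]
    by (simp add: one cox_mult_class in_lists_conv_set cox_class_eq_iff)
  then show "\<exists>y\<in>carrier ?G. y \<otimes>\<^bsub>?G\<^esub> x = \<one>\<^bsub>?G\<^esub>"
    using u by (auto simp: car in_lists_conv_set intro!: bexI[of _ "cox_class I m (rev u)"])
  fix y assume "y \<in> carrier ?G"
  then obtain v where v: "y = cox_class I m v" "v \<in> lists I" by (auto simp: car)
  show "x \<otimes>\<^bsub>?G\<^esub> y \<in> carrier ?G" using u v by (auto simp: car cox_mult_class)
  fix z assume "z \<in> carrier ?G"
  then obtain w where w: "z = cox_class I m w" "w \<in> lists I" by (auto simp: car)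
  show "x \<otimes>\<^bsub>?G\<^esub> y \<otimes>\<^bsub>?G\<^esub> z = x \<otimes>\<^bsub>?G\<^esub> (y \<otimes>\<^bsub>?G\<^esub> z)"
    using u v w by (simp add: cox_mult_class in_lists_conv_set ball_Un)
qed


section \<open>Length, full commutativity, descents\<close>

text \<open>Expressions are words in the indices of the generators.\<close>

definition cox_expressions :: "'a set \<Rightarrow> ('a \<Rightarrow> 'a \<Rightarrow> nat) \<Rightarrow> 'a list set \<Rightarrow> 'a list set" where
  "cox_expressions I m w =
    {u \<in> lists I. foldr (\<lambda>s x. cox_gen I m s \<otimes>\<^bsub>coxeter_group I m\<^esub> x) u
                    \<one>\<^bsub>coxeter_group I m\<^esub> = w}"

definition cox_length :: "'a set \<Rightarrow> ('a \<Rightarrow> 'a \<Rightarrow> nat) \<Rightarrow> 'a list set \<Rightarrow> nat" where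
  "cox_length I m w = (LEAST k. \<exists>u \<in> cox_expressions I m w. length u = k)"

definition reduced_expressions :: "'a set \<Rightarrow> ('a \<Rightarrow> 'a \<Rightarrow> nat) \<Rightarrow> 'a list set \<Rightarrow> 'a list set" where
  "reduced_expressions I m w = {u \<in> cox_expressions I m w. length u = cox_length I m w}"

inductive commutation :: "('a \<Rightarrow> 'a \<Rightarrow> nat) \<Rightarrow> 'a list \<Rightarrow> 'a list \<Rightarrow> bool"
  for m :: "'a \<Rightarrow> 'a \<Rightarrow> nat" where
  "m s t = 2 \<Longrightarrow> commutation m (u @ [s, t] @ v) (u @ [t, s] @ v)"

definition fully_commutative :: "'a set \<Rightarrow> ('a \<Rightarrow> 'a \<Rightarrow> nat) \<Rightarrow> 'a list set \<Rightarrow> bool" where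
  "fully_commutative I m w \<longleftrightarrow>
    (\<forall>u \<in> reduced_expressions I m w. \<forall>v \<in> reduced_expressions I m w. (commutation m)\<^sup>*\<^sup>* u v)"

definition FC_involutions :: "'a set \<Rightarrow> ('a \<Rightarrow> 'a \<Rightarrow> nat) \<Rightarrow> 'a list set set" where
  "FC_involutions I m =
    {w \<in> carrier (coxeter_group I m). fully_commutative I m w \<and>
       w \<otimes>\<^bsub>coxeter_group I m\<^esub> w = \<one>\<^bsub>coxeter_group I m\<^esub>}"

text \<open>The descent set is given by the indices of the descents.\<close>

definition right_descents :: "'a set \<Rightarrow> ('a \<Rightarrow> 'a \<Rightarrow> nat) \<Rightarrow> 'a list set \<Rightarrow> 'a set" where
  "right_descents I m w =
    {s \<in> I. cox_length I m (w \<otimes>\<^bsub>coxeter_group I m\<^esub> cox_gen I m s) < cox_length I m w}"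

definition maj :: "nat set \<Rightarrow> (nat \<Rightarrow> nat \<Rightarrow> nat) \<Rightarrow> nat list set \<Rightarrow> nat" where
  "maj I m w = \<Sum>(right_descents I m w)"


section \<open>Type \<open>B\<^sub>n\<close>\<close>

text \<open>Among adjacent indices in \<open>{1..n}\<close>, the pair with larger element \<open>n\<close> is \<open>{n - 1, n}\<close>.\<close>

definition B_matrix :: "nat \<Rightarrow> nat \<Rightarrow> nat \<Rightarrow> nat" where
  "B_matrix n i j =
    (if i = j then 1
     else if j = Suc i \<or> i = Suc j then (if max i j = n then 4 else 3)
     else 2)"

lemma group_B: "group (coxeter_group {1..n} (B_matrix n))"
  by (rule group_coxeter_group) (simp add: B_matrix_def)


section \<open>\<open>q\<close>-binomial coefficients\<close>

definition qbinomial :: "'a::field \<Rightarrow> nat \<Rightarrow> nat \<Rightarrow> 'a" where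
  "qbinomial q n k =
    (\<Prod>j=1..n. 1 - q ^ j) / ((\<Prod>j=1..k. 1 - q ^ j) * (\<Prod>j=1..n-k. 1 - q ^ j))"

text \<open>The indeterminate of the field of rational functions over the rationals.\<close>

definition qvar :: "rat poly fract" where
  "qvar = Fract [:0, 1:] 1"

end

theory Submission
  imports Defs "HOL-Library.Sublist"
begin

text \<open>
  A word is a reduced expression of a fully commutative element iff no word obtained from it by
  commutations contains a square or a long braid; such an element is determined by the
  commutation class of its reduced expressions, and it is an involution iff that class is stable
  under reversal. A commutation class over \<open>s\<^sub>1, \<dots>, s\<^sub>n\<close> is in turn determined by its restrictions
  to the pairs \<open>{s\<^sub>i, s\<^sub>i\<^sub>+\<^sub>1}\<close>.

  For an involution these restrictions are palindromes. If they all alternate, the numbers \<open>c\<^sub>i\<close> of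
  occurrences of \<open>s\<^sub>i\<close> form a path that starts at height \<open>0\<close>, has steps \<open>1\<close> and \<open>-1\<close>, and may stay at
  height \<open>0\<close>; all \<open>2\<^sup>n\<close> such paths occur. Otherwise there is a least \<open>j\<close> with two successive \<open>s\<^sub>j\<close> not
  separated by \<open>s\<^sub>j\<^sub>-\<^sub>1\<close>. Up to commutations this forces a factor \<open>s\<^sub>j \<cdots> s\<^sub>n \<cdots> s\<^sub>j\<close> containing all letters above \<open>j\<close>, and
  contracting it to \<open>s\<^sub>j\<close> leaves an alternating path of length \<open>j\<close> ending at height \<open>1\<close>.

  In both cases the descents are the positions of the peaks of the path, a final up-step being a
  peak. Let \<open>P n h\<close> be the generating function of the sum of the peak positions over paths of length
  \<open>n\<close> ending at height \<open>h\<close>, a final up-step not being counted. Recursion on the last steps gives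
  \<open>P n h = qbinomial q n ((n - h) div 2)\<close>. All paths together give \<open>1\<close> plus the double sum, and the
  second case telescopes to \<open>P n 0 - 1\<close>.
\<close>

section \<open>Fully commutative elements of Coxeter groups\<close>

fun alt :: "'a \<Rightarrow> 'a \<Rightarrow> nat \<Rightarrow> 'a list" where
  "alt a b 0 = []"
| "alt a b (Suc k) = a # alt b a k"

lemma length_alt [simp]: "length (alt a b k) = k"
  by (induction k arbitrary: a b) auto

lemma alt_add: "alt a b (k + l) = alt a b k @ (if even k then alt a b l else alt b a l)"
  by (induction k arbitrary: a b) auto

lemma alt_double: "alt a b (2 * k) = concat (replicate k [a, b])"
  by (induction k) auto

lemma alt_snoc_rev: "alt a b (Suc k) = alt a b k @ [if even k then a else b]"
  by (induction k arbitrary: a b) auto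

lemma alt_odd: "alt a b (Suc (2 * k)) = alt a b k @ [if even k then a else b] @ rev (alt a b k)"
proof (induction k arbitrary: a b)
  case (Suc k)
  have "alt a b (Suc (2 * Suc k)) = a # alt b a (Suc (Suc (2 * k)))" by simp
  also have "\<dots> = a # alt b a (Suc (2 * k)) @ [a]"
    by (subst alt_snoc_rev) simp
  also have "\<dots> = a # alt b a k @ [if even k then b else a] @ rev (alt b a k) @ [a]"
    by (subst Suc.IH) simp
  also have "\<dots> = alt a b (Suc k) @ [if even (Suc k) then a else b] @ rev (alt a b (Suc k))"
    by auto
  finally show ?case .
qed auto

lemma rev_alt_odd: "rev (alt a b (Suc (2 * k))) = alt a b (Suc (2 * k))"
  by (subst (1 2) alt_odd) simp

lemma rev_alt: "rev (alt a b k) = (if even k then alt b a k else alt a b k)"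
proof (induction k arbitrary: a b)
  case (Suc k)
  show ?case
    using alt_snoc_rev[of a b k] alt_snoc_rev[of b a k] by (simp add: Suc.IH)
qed simp

lemma alt_in_lists: "a \<in> I \<Longrightarrow> b \<in> I \<Longrightarrow> alt a b k \<in> lists I"
  by (induction k arbitrary: a b) auto

lemma rev_in_lists [simp]: "rev u \<in> lists I \<longleftrightarrow> u \<in> lists I"
  by (auto simp: in_lists_conv_set)

section \<open>Coxeter systems and cancellation\<close>

text \<open>The presentation bounds the order of a product \<open>s t\<close> only from above by
  \<open>m s t\<close>. The assumption \<open>order\<close> adds the bound from below, and
  \<open>off_diag\<close> excludes infinite labels.\<close>

locale coxeter_system =
  fixes I :: "'a set" and m :: "'a \<Rightarrow> 'a \<Rightarrow> nat"
  assumes diag: "s \<in> I \<Longrightarrow> m s s = 1"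
    and sym: "m s t = m t s"
    and off_diag: "s \<noteq> t \<Longrightarrow> 2 \<le> m s t"
    and order: "\<lbrakk>s \<in> I; t \<in> I; 0 < j; j < m s t\<rbrakk> \<Longrightarrow> \<not> cox_eq I m (alt s t (2 * j)) []"
begin

abbreviation eqv (infix "\<approx>" 50) where "u \<approx> v \<equiv> cox_eq I m u v"
abbreviation comm (infix "\<sim>" 50) where "u \<sim> v \<equiv> (commutation m)\<^sup>*\<^sup>* u v"

lemma eqv_refl [simp]: "u \<in> lists I \<Longrightarrow> u \<approx> u" by (rule cox_eq.refl)
lemmas eqv_sym = cox_eq.sym[of I m]
lemmas eqv_trans [trans] = cox_eq.trans[of I m]

lemma eqv_lists: "u \<approx> v \<Longrightarrow> u \<in> lists I" "u \<approx> v \<Longrightarrow> v \<in> lists I"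
  using cox_eq_lists[of I m u v] by auto

lemma eqv_ctxt: "u \<approx> v \<Longrightarrow> a \<in> lists I \<Longrightarrow> b \<in> lists I \<Longrightarrow> a @ u @ b \<approx> a @ v @ b"
  by (rule cox_eq_ctxt)

lemma rev_left: "u \<in> lists I \<Longrightarrow> rev u @ u \<approx> []"
  by (rule cox_eq_rev) (auto simp: diag)

lemma rev_right: "u \<in> lists I \<Longrightarrow> u @ rev u \<approx> []"
  using rev_left[of "rev u"] by simp

lemma square: "x \<in> lists I \<Longrightarrow> y \<in> lists I \<Longrightarrow> s \<in> I \<Longrightarrow> x @ [s, s] @ y \<approx> x @ y"
  using cox_eq.relator[of x I y s s m] by (simp add: diag)

lemma cancel_left:
  assumes "u @ v \<approx> u @ w"
  shows "v \<approx> w"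
proof -
  have l: "u \<in> lists I" "v \<in> lists I" "w \<in> lists I" using eqv_lists[OF assms] by auto
  have "v \<approx> rev u @ u @ v" using l eqv_sym[OF eqv_ctxt[OF rev_left[OF l(1)], of "[]" v]] by simp
  also have "\<dots> \<approx> rev u @ u @ w" using eqv_ctxt[OF assms, of "rev u" "[]"] l by simp
  also have "\<dots> \<approx> w" using l eqv_ctxt[OF rev_left[OF l(1)], of "[]" w] by simp
  finally show ?thesis .
qed

lemma cancel_right:
  assumes "v @ u \<approx> w @ u"
  shows "v \<approx> w"
proof -
  have l: "u \<in> lists I" "v \<in> lists I" "w \<in> lists I" using eqv_lists[OF assms] by auto
  have "v \<approx> v @ u @ rev u" using l eqv_sym[OF eqv_ctxt[OF rev_right[OF l(1)], of v "[]"]] by simp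
  also have "\<dots> \<approx> w @ u @ rev u" using eqv_ctxt[OF assms, of "[]" "rev u"] l by simp
  also have "\<dots> \<approx> w" using l eqv_ctxt[OF rev_right[OF l(1)], of w "[]"] by simp
  finally show ?thesis .
qed

lemma eqv_even_length: "u \<approx> v \<Longrightarrow> even (length u) = even (length v)"
proof (induction rule: cox_eq.induct)
  case (relator u v s t)
  then show ?case using alt_double[of s t "m s t"] length_alt[of s t "2 * m s t"] by simp
qed auto

section \<open>Reflections of a word\<close>

text \<open>Each letter yields a reflection, namely its conjugate by everything read before it. The
  accumulated prefix \<open>p\<close> makes the list split along a concatenation.\<close>

fun reflections :: "'a list \<Rightarrow> 'a list \<Rightarrow> 'a list list" where
  "reflections p [] = []"
| "reflections p (a # u) = (p @ [a] @ rev p) # reflections (p @ [a]) u"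

definition multiplicity :: "'a list \<Rightarrow> 'a list \<Rightarrow> 'a list \<Rightarrow> nat" where
  "multiplicity p u g = length (filter (\<lambda>r. r \<approx> g) (reflections p u))"

lemma reflections_append: "reflections p (u @ v) = reflections p u @ reflections (p @ u) v"
  by (induction u arbitrary: p) auto

lemma multiplicity_append: "multiplicity p (u @ v) g = multiplicity p u g + multiplicity (p @ u) v g"
  by (simp add: multiplicity_def reflections_append)

text \<open>A prefix of an alternating word, the next letter and the reversed prefix form an
  alternating word again (\<open>alt_odd\<close>), so the reflections of an alternating word are its
  odd alternating words.\<close>

lemma reflections_alt:
  "reflections (p @ alt s t j) (if even j then alt s t k else alt t s k) =
     map (\<lambda>i. p @ alt s t (Suc (2 * i)) @ rev p) [j..<j + k]"
proof (induction k arbitrary: j)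
  case (Suc k)
  have *: "p @ alt s t j @ [if even j then s else t] = p @ alt s t (Suc j)"
    using alt_snoc_rev[of s t j] by (simp del: alt.simps)
  have "reflections (p @ alt s t j) (if even j then alt s t (Suc k) else alt t s (Suc k)) =
    ((p @ alt s t j) @ [if even j then s else t] @ rev (p @ alt s t j)) #
      reflections (p @ alt s t (Suc j)) (if even (Suc j) then alt s t k else alt t s k)"
    using * by auto
  also have "\<dots> = (p @ alt s t (Suc (2 * j)) @ rev p) # map (\<lambda>i. p @ alt s t (Suc (2 * i)) @ rev p) [Suc j..<Suc j + k]"
    by (subst alt_odd, subst Suc.IH) simp
  also have "\<dots> = map (\<lambda>i. p @ alt s t (Suc (2 * i)) @ rev p) [j..<j + Suc k]"
    by (subst (2) upt_conv_Cons) auto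
  finally show ?case .
qed simp

text \<open>Since \<open>alt s t (2 * m s t)\<close> is trivial, the \<open>2 * m s t\<close>
  reflections of the relator repeat with period \<open>m s t\<close>, and therefore cancel in
  pairs.\<close>

lemma even_multiplicity_relator:
  assumes "s \<in> I" "t \<in> I" "p \<in> lists I"
  shows "even (multiplicity p (concat (replicate (m s t) [s, t])) g)"
proof -
  let ?m = "m s t"
  let ?f = "\<lambda>i. p @ alt s t (Suc (2 * i)) @ rev p"
  let ?Q = "\<lambda>i. ?f i \<approx> g"
  have per: "?f (i + ?m) \<approx> ?f i" for i
  proof -
    have "alt s t (2 * ?m) \<approx> []"
      using cox_eq.relator[of "[]" I "[]" s t m] assms by (simp add: alt_double)
    moreover have "alt s t (Suc (2 * (i + ?m))) = alt s t (2 * ?m) @ alt s t (Suc (2 * i))"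
      using alt_add[of s t "2 * ?m" "Suc (2 * i)"] by (simp add: algebra_simps)
    ultimately show ?thesis
      using eqv_ctxt[of "alt s t (2 * ?m)" "[]" p "alt s t (Suc (2 * i)) @ rev p"] assms
      by (simp add: alt_in_lists del: alt.simps)
  qed
  then have Q: "?Q (i + ?m) \<longleftrightarrow> ?Q i" for i
    by (meson eqv_sym eqv_trans)
  have "reflections p (alt s t (2 * ?m)) = map ?f [0..<2 * ?m]"
    using reflections_alt[of p s t 0 "2 * ?m"] by simp
  also have "[0..<2 * ?m] = [0..<?m] @ map (\<lambda>i. i + ?m) [0..<?m]"
    using upt_add_eq_append[of 0 ?m ?m] by (simp add: map_add_upt mult_2)
  finally have "multiplicity p (alt s t (2 * ?m)) g = 2 * length (filter ?Q [0..<?m])"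
    using Q by (simp add: multiplicity_def filter_map o_def del: alt.simps)
  then show ?thesis by (simp add: alt_double)
qed

lemma multiplicity_cong:
  assumes "p \<approx> p'" "u \<in> lists I"
  shows "multiplicity p u g = multiplicity p' u g"
  using assms
proof (induction u arbitrary: p p')
  case (Cons a u)
  have l: "p \<in> lists I" "p' \<in> lists I" "a \<in> I" using eqv_lists[OF Cons.prems(1)] Cons.prems by auto
  have "rev p \<approx> rev p'"
  proof (rule cancel_left)
    have "p @ rev p \<approx> []" using rev_right l by blast
    also have "[] \<approx> p' @ rev p'" using rev_right l eqv_sym by blast
    also have "\<dots> \<approx> p @ rev p'" using eqv_ctxt[OF eqv_sym[OF Cons.prems(1)], of "[]" "rev p'"] l by simp
    finally show "p @ rev p \<approx> p @ rev p'" .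
  qed
  then have "p @ [a] @ rev p \<approx> p' @ [a] @ rev p'"
    using cox_eq_append[OF Cons.prems(1)] cox_eq_append[of I m "[a]" "[a]" "rev p" "rev p'"] l by auto
  then have "p @ [a] @ rev p \<approx> g \<longleftrightarrow> p' @ [a] @ rev p' \<approx> g"
    by (meson eqv_sym eqv_trans)
  moreover have "multiplicity (p @ [a]) u g = multiplicity (p' @ [a]) u g"
    using Cons eqv_ctxt[OF Cons.prems(1), of "[]" "[a]"] by simp
  ultimately show ?case by (simp add: multiplicity_def)
qed (simp add: multiplicity_def)

text \<open>The group element determines the parity with which each reflection occurs; the exchange property
  follows without assuming that a product \<open>s t\<close> has order exactly \<open>m s t\<close>.\<close>

lemma multiplicity_parity:
  assumes "u \<approx> v" "p \<in> lists I"
  shows "even (multiplicity p u g) = even (multiplicity p v g)"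
  using assms
proof (induction arbitrary: p rule: cox_eq.induct)
  case (relator u v s t)
  let ?r = "concat (replicate (m s t) [s, t])"
  have "(p @ u) @ ?r \<approx> p @ u"
    using cox_eq.relator[of "p @ u" I "[]" s t m] relator by simp
  then have "multiplicity ((p @ u) @ ?r) v g = multiplicity (p @ u) v g"
    by (rule multiplicity_cong) fact
  then show ?case
    using even_multiplicity_relator[of s t "p @ u" g] relator by (simp add: multiplicity_append)
qed auto

lemma reflections_mem:
  assumes "r \<in> set (reflections p u)"
  obtains u1 a u2 where "u = u1 @ a # u2" "r = (p @ u1) @ [a] @ rev (p @ u1)"
  using assms
proof (induction u arbitrary: p thesis)
  case (Cons b u)
  show ?case
  proof (cases "r = p @ [b] @ rev p")
    case True then show ?thesis using Cons.prems(1)[of "[]" b u] by simp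
  next
    case False
    then have "r \<in> set (reflections (p @ [b]) u)" using Cons.prems by auto
    then obtain u1 a u2 where "u = u1 @ a # u2" "r = ((p @ [b]) @ u1) @ [a] @ rev ((p @ [b]) @ u1)"
      using Cons.IH by blast
    then show ?thesis using Cons.prems(1)[of "b # u1" a u2] by simp
  qed
qed simp

text \<open>Left multiplication by the reflection \<open>u1 a rev u1\<close> cancels
  \<open>u1\<close>, then the letter \<open>a\<close>, so it deletes the letter from which the
  reflection comes.\<close>

lemma multiplicity_pos:
  assumes "multiplicity [] u g \<noteq> 0" "u \<in> lists I"
  obtains u1 a u2 where "u = u1 @ a # u2" "g @ u \<approx> u1 @ u2"
proof -
  obtain r where r: "r \<in> set (reflections [] u)" "r \<approx> g"
    using assms(1) by (auto simp: multiplicity_def filter_empty_conv)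
  obtain u1 a u2 where u: "u = u1 @ a # u2" "r = u1 @ [a] @ rev u1"
    using reflections_mem[OF r(1)] by auto
  then have l: "u1 \<in> lists I" "a \<in> I" "u2 \<in> lists I" using assms(2) by auto
  have "g @ u \<approx> (u1 @ [a]) @ (rev u1 @ u1) @ (a # u2)"
    using eqv_ctxt[OF eqv_sym[OF r(2)], of "[]" u] u l by simp
  also have "\<dots> \<approx> (u1 @ [a]) @ [] @ (a # u2)"
    by (rule eqv_ctxt) (use l rev_left in auto)
  also have "\<dots> \<approx> u1 @ u2" using square[of u1 u2 a] l by simp
  finally show ?thesis using that u by blast
qed

section \<open>Reduced words and the exchange property\<close>

definition reduced :: "'a list \<Rightarrow> bool" where
  "reduced u \<longleftrightarrow> u \<in> lists I \<and> (\<forall>v. v \<approx> u \<longrightarrow> length u \<le> length v)"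

lemma reduced_in_lists: "reduced u \<Longrightarrow> u \<in> lists I"
  by (simp add: reduced_def)

lemma reduced_eqv: "reduced u \<Longrightarrow> v \<approx> u \<Longrightarrow> length v = length u \<Longrightarrow> reduced v"
  unfolding reduced_def by (metis eqv_trans eqv_lists(1))

lemma reduced_exists:
  assumes "u \<in> lists I"
  obtains v where "reduced v" "v \<approx> u" "length v \<le> length u"
proof -
  define v where "v = (ARG_MIN length v. v \<approx> u)"
  have "v \<approx> u" "\<forall>y. y \<approx> u \<longrightarrow> length v \<le> length y"
    unfolding v_def using arg_min_nat_lemma[of "\<lambda>v. v \<approx> u" u length] assms by auto
  then show ?thesis
    using that[of v] assms unfolding reduced_def by (meson eqv_refl eqv_trans eqv_lists)
qed

text \<open>Left multiplication by \<open>?g\<close> turns \<open>u\<close> into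
  \<open>u @ [s]\<close>, and the last letter of \<open>u @ [s]\<close> contributes exactly the
  reflection \<open>?g\<close>. By parity \<open>?g\<close> is then a reflection of \<open>u\<close>
  or of \<open>v\<close>. In the first case a letter of \<open>u\<close> is deleted; in the second,
  deleting a letter of \<open>v\<close> would give an expression of \<open>u\<close> that is too
  short.\<close>

lemma exchange:
  assumes "reduced u" "s \<in> I" "v \<approx> u @ [s]" "length v < length u"
  obtains u1 a u2 where "u = u1 @ a # u2" "u1 @ u2 \<approx> u @ [s]"
proof -
  let ?g = "u @ [s] @ rev u"
  have l: "u \<in> lists I" "v \<in> lists I" using assms(1,3) reduced_in_lists eqv_lists by auto
  have gu: "?g @ u \<approx> u @ [s]"
    using eqv_ctxt[OF rev_left[OF l(1)], of "u @ [s]" "[]"] l assms(2) by simp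
  have "multiplicity [] (u @ [s]) ?g = Suc (multiplicity [] u ?g)"
    using l assms(2) by (simp add: multiplicity_def reflections_append)
  moreover have "even (multiplicity [] (u @ [s]) ?g) = even (multiplicity [] v ?g)"
    by (rule multiplicity_parity) (use assms(3) eqv_sym in auto)
  ultimately consider "multiplicity [] u ?g \<noteq> 0" | "multiplicity [] v ?g \<noteq> 0"
    by (metis even_Suc even_zero)
  then show ?thesis
  proof cases
    case 1
    then obtain u1 a u2 where "u = u1 @ a # u2" "?g @ u \<approx> u1 @ u2"
      using multiplicity_pos l by blast
    moreover from this gu have "u1 @ u2 \<approx> u @ [s]" by (meson eqv_sym eqv_trans)
    ultimately show ?thesis using that by blast
  next
    case 2
    then obtain v1 a v2 where v: "v = v1 @ a # v2" "?g @ v \<approx> v1 @ v2"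
      using multiplicity_pos l by blast
    have "v1 @ v2 \<approx> ?g @ v" using v eqv_sym by blast
    also have "\<dots> \<approx> ?g @ u @ [s]"
      using eqv_ctxt[OF assms(3), of ?g "[]"] l assms(2) by simp
    also have "\<dots> \<approx> (u @ [s]) @ [s]"
      using eqv_ctxt[OF gu, of "[]" "[s]"] assms(2) by simp
    also have "\<dots> \<approx> u" using square[of u "[]" s] l assms(2) by simp
    finally have "length u \<le> length (v1 @ v2)" using assms(1) unfolding reduced_def by blast
    then show ?thesis using v assms(4) by simp
  qed
qed

text \<open>If a reduced word can end in \<open>s\<close> and in \<open>t\<close>, it can end in an
  alternating word of any length up to \<open>m s t\<close>. The induction exchanges the roles of
  \<open>s\<close> and \<open>t\<close>: appending \<open>s\<close> to an expression with suffix
  \<open>rev (alt t s k)\<close> deletes a letter. If that letter precedes the suffix, the suffix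
  has grown by \<open>s\<close>.\<close>

lemma dihedral_suffix:
  assumes u: "reduced u" and x: "x @ [s] \<approx> u" "length u = Suc (length x)"
    and y: "y @ [t] \<approx> u" "length u = Suc (length y)"
    and st: "k \<le> m s t"
  shows "\<exists>z. z @ rev (alt s t k) \<approx> u \<and> length z + k = length u"
  using x y st
proof (induction k arbitrary: s t x y)
  case 0
  then show ?case using reduced_in_lists[OF u] by (intro exI[of _ u]) simp
next
  case (Suc k)
  have I: "s \<in> I" "t \<in> I" "x \<in> lists I"
    using eqv_lists(1)[OF Suc.prems(1)] eqv_lists(1)[OF Suc.prems(3)] by auto
  obtain z where z: "z @ rev (alt t s k) \<approx> u" "length z + k = length u"
    using Suc.IH[of y t x s] Suc.prems sym[of s t] by auto
  let ?U = "z @ rev (alt t s k)"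
  have U: "reduced ?U" using reduced_eqv[OF u z(1)] z(2) by simp
  have "?U @ [s] \<approx> u @ [s]" using eqv_ctxt[OF z(1), of "[]" "[s]"] I by simp
  also have us: "\<dots> \<approx> x @ [s, s]" using eqv_ctxt[OF eqv_sym[OF Suc.prems(1)], of "[]" "[s]"] I by simp
  also have "\<dots> \<approx> x" using square[of x "[]" s] I by simp
  finally have "x \<approx> ?U @ [s]" by (rule eqv_sym)
  moreover have "length x < length ?U" using z(2) Suc.prems by simp
  ultimately obtain u1 a u2 where d: "?U = u1 @ a # u2" "u1 @ u2 \<approx> ?U @ [s]"
    using exchange[OF U I(1)] by metis
  consider z2 where "z = u1 @ a # z2" "u2 = z2 @ rev (alt t s k)"
    | r where "u1 = z @ r" "rev (alt t s k) = r @ a # u2"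
    using d(1) by (auto simp: append_eq_append_conv2 append_eq_Cons_conv)
  then show ?case
  proof cases
    case 1
    have "(u1 @ z2) @ rev (alt s t (Suc k)) \<approx> (?U @ [s]) @ [s]"
      using eqv_ctxt[OF d(2), of "[]" "[s]"] 1 I by simp
    also have "\<dots> \<approx> ?U" using square[of ?U "[]" s] I U reduced_in_lists[OF U] by simp
    also have "\<dots> \<approx> u" by (rule z)
    finally show ?thesis
      using 1 z by (intro exI[of _ "u1 @ z2"]) simp
  next
    case 2
    \<comment> \<open>The deleted letter lies in the alternating suffix, with \<open>i\<close>
      letters after it. Cancelling what precedes it leaves
      \<open>alt t s (2 * Suc i) \<approx> []\<close>, where \<open>Suc i\<close> is below the order
      of the product.\<close>
    define i where "i = length u2"
    have l: "z \<in> lists I" "r \<in> lists I" "a \<in> I" "u2 \<in> lists I"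
    proof -
      have *: "z @ r @ a # u2 \<in> lists I" using reduced_in_lists[OF U] unfolding 2(2) .
      show "z \<in> lists I" "r \<in> lists I" "a \<in> I" "u2 \<in> lists I" using * by (simp_all only: append_in_lists_conv Cons_in_lists_iff)
    qed
    have e: "alt t s k = rev u2 @ a # rev r"
      using arg_cong[OF 2(2), of rev] by simp
    then have k: "k = i + Suc (length r)"
      by (metis i_def length_alt length_append length_Cons length_rev)
    have "alt t s i @ (if even i then alt t s (Suc (length r)) else alt s t (Suc (length r))) = rev u2 @ a # rev r"
      using e unfolding k alt_add by simp
    then have i: "alt t s i = rev u2" "(if even i then t else s) = a"
      by (auto simp: i_def append_eq_append_conv split: if_splits)
    have "(z @ r) @ u2 \<approx> (z @ r) @ (a # u2 @ [s])" using d(2) 2 by simp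
    then have "u2 \<approx> a # u2 @ [s]" by (rule cancel_left)
    then have "rev u2 @ u2 \<approx> rev u2 @ a # u2 @ [s]"
      using eqv_ctxt[of u2 "a # u2 @ [s]" "rev u2" "[]"] l by simp
    then have "rev u2 @ a # u2 @ [s] \<approx> []"
      using rev_left[OF l(4)] by (meson eqv_sym eqv_trans)
    moreover have "alt t s (2 * Suc i) = rev u2 @ a # u2 @ [s]"
      using alt_snoc_rev[of t s "Suc (2 * i)"] alt_odd[of t s i] i by (auto simp del: alt.simps)
    ultimately have "alt t s (2 * Suc i) \<approx> []" by simp
    then show ?thesis
      using order[of t s "Suc i"] I k Suc.prems(5) sym[of s t] by simp
  qed
qed

section \<open>Commutation classes\<close>

lemma comm_sym: "u \<sim> v \<Longrightarrow> v \<sim> u"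
proof (induction rule: rtranclp_induct)
  case (step v w)
  then obtain a s t b where "v = a @ [s, t] @ b" "w = a @ [t, s] @ b" "m s t = 2"
    by (auto elim: commutation.cases)
  then have "commutation m w v"
    using commutation.intros[of m t s a b] sym[of s t] by simp
  then show ?case using step by (meson converse_rtranclp_into_rtranclp)
qed simp

lemma comm_ctxt: "u \<sim> v \<Longrightarrow> x @ u @ y \<sim> x @ v @ y"
proof (induction rule: rtranclp_induct)
  case (step v w)
  then obtain a s t b where "v = a @ [s, t] @ b" "w = a @ [t, s] @ b" "m s t = 2"
    by (auto elim: commutation.cases)
  then have "commutation m (x @ v @ y) (x @ w @ y)"
    using commutation.intros[of m s t "x @ a" "b @ y"] by simp
  then show ?case using step by simp
qed simp

lemma comm_set: "u \<sim> v \<Longrightarrow> set u = set v"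
proof (induction rule: rtranclp_induct)
  case (step v w)
  from step(2) have "set v = set w" by cases auto
  then show ?case using step.IH by simp
qed simp

lemma comm_length: "u \<sim> v \<Longrightarrow> length u = length v"
proof (induction rule: rtranclp_induct)
  case (step v w)
  from step(2) have "length v = length w" by cases auto
  then show ?case using step.IH by simp
qed simp

lemma comm_rev: "u \<sim> v \<Longrightarrow> rev u \<sim> rev v"
proof (induction rule: rtranclp_induct)
  case (step v w)
  then obtain a s t b where "v = a @ [s, t] @ b" "w = a @ [t, s] @ b" "m s t = 2"
    by (auto elim: commutation.cases)
  then have "commutation m (rev v) (rev w)"
    using commutation.intros[of m t s "rev b" "rev a"] sym[of s t] by simp
  then show ?case using step by simp
qed simp

text \<open>A swap involves two letters with label \<open>2\<close>, so two distinct swapped letters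
  are never both kept in the restriction to a pair with another label.\<close>

lemma comm_filter:
  assumes "u \<sim> v" "m s t \<noteq> 2"
  shows "filter (\<lambda>x. x = s \<or> x = t) u = filter (\<lambda>x. x = s \<or> x = t) v"
  using assms(1)
proof (induction rule: rtranclp_induct)
  case (step v w)
  then obtain a p q b where "v = a @ [p, q] @ b" "w = a @ [q, p] @ b" "m p q = 2"
    by (auto elim: commutation.cases)
  moreover have "m q p \<noteq> 2 \<or> p \<noteq> t \<or> q \<noteq> s" "p \<noteq> s \<or> q \<noteq> t"
    using assms(2) \<open>m p q = 2\<close> by auto
  moreover have "m q p = 2" using \<open>m p q = 2\<close> sym[of p q] by simp
  ultimately show ?case using step by auto
qed simp

lemma comm_move:
  assumes "\<And>b. b \<in> set y \<Longrightarrow> m s b = 2"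
  shows "x @ [s] @ y @ z \<sim> x @ y @ [s] @ z"
  using assms
proof (induction y arbitrary: x)
  case (Cons b y)
  have "commutation m (x @ [s, b] @ (y @ z)) (x @ [b, s] @ (y @ z))"
    by (rule commutation.intros) (simp add: Cons.prems)
  moreover have "(x @ [b]) @ [s] @ y @ z \<sim> (x @ [b]) @ y @ [s] @ z"
    by (rule Cons.IH) (simp add: Cons.prems)
  ultimately show ?case by simp
qed simp

lemma alt_eqv:
  assumes "s \<in> I" "t \<in> I"
  shows "alt s t (m s t) \<approx> alt t s (m s t)"
proof (rule cancel_right)
  let ?k = "m s t"
  have "alt s t ?k @ rev (alt t s ?k) = alt s t (2 * ?k)"
    using alt_add[of s t ?k ?k] by (simp add: mult_2 rev_alt)
  also have "\<dots> \<approx> []"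
    using cox_eq.relator[of "[]" I "[]" s t m] assms by (simp add: alt_double)
  also have "[] \<approx> alt t s ?k @ rev (alt t s ?k)"
    by (intro eqv_sym[OF rev_right] alt_in_lists assms)
  finally show "alt s t ?k @ rev (alt t s ?k) \<approx> alt t s ?k @ rev (alt t s ?k)" .
qed

lemma comm_eqv:
  assumes "u \<sim> v" "u \<in> lists I"
  shows "u \<approx> v"
  using assms
proof (induction rule: rtranclp_induct)
  case (step v w)
  then obtain a s t b where vw: "v = a @ [s, t] @ b" "w = a @ [t, s] @ b" "m s t = 2"
    by (auto elim: commutation.cases)
  have "v \<in> lists I" using step eqv_lists by blast
  then have "v \<approx> w"
    using alt_eqv[of s t] eqv_ctxt[of "[s, t]" "[t, s]" a b] vw by (simp add: numeral_eq_Suc)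
  then show ?case using step eqv_trans by blast
qed simp

section \<open>Words avoiding squares and long braids\<close>

definition good :: "'a list \<Rightarrow> bool" where
  "good u \<longleftrightarrow> u \<in> lists I \<and> (\<forall>v. u \<sim> v \<longrightarrow>
     (\<forall>x y s. v \<noteq> x @ [s, s] @ y) \<and> (\<forall>x y s t. 3 \<le> m s t \<longrightarrow> v \<noteq> x @ alt s t (m s t) @ y))"

lemma good_in_lists: "good u \<Longrightarrow> u \<in> lists I"
  by (simp add: good_def)

lemma good_comm: "good u \<Longrightarrow> u \<sim> v \<Longrightarrow> good v"
  unfolding good_def in_lists_conv_set using comm_set[of u v] rtranclp_trans[of "commutation m" u v]
  by simp

lemma good_no_square: "good u \<Longrightarrow> \<not> u \<sim> x @ [s, s] @ y"
  unfolding good_def by metis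

lemma good_no_braid: "good u \<Longrightarrow> 3 \<le> m s t \<Longrightarrow> \<not> u \<sim> x @ alt s t (m s t) @ y"
  unfolding good_def by metis

lemma good_prefix:
  assumes "good (u @ y)"
  shows "good u"
proof -
  have "v \<noteq> a @ [s, s] @ b" "3 \<le> m s t \<Longrightarrow> v \<noteq> a @ alt s t (m s t) @ b" if "u \<sim> v" for v a b s t
    using comm_ctxt[OF that, of "[]" y] good_no_square[OF assms, of a s "b @ y"]
      good_no_braid[OF assms, of s t a "b @ y"]
    by auto
  then show ?thesis using good_in_lists[OF assms] unfolding good_def by auto
qed

text \<open>Both claims are proved together by induction on the length, with
  \<open>u = u' @ [t]\<close>. If \<open>u\<close> were not reduced, a shorter expression
  \<open>x\<close> would make \<open>x @ [t]\<close> a reduced expression of \<open>u'\<close>, and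
  uniqueness for \<open>u'\<close> would produce a square in the class of \<open>u\<close>. If
  \<open>v\<close> ends in \<open>s\<close>, different from \<open>t\<close>,
  \<open>dihedral_suffix\<close> and uniqueness for \<open>u'\<close> bring \<open>u\<close> to a
  word with an alternating suffix of length \<open>m s t\<close>. This length must be
  \<open>2\<close>, so \<open>u\<close> can also end in \<open>s\<close>, and uniqueness for the
  remaining prefix applies.\<close>

lemma good_reduced_unique:
  assumes "good u"
  shows "reduced u \<and> (\<forall>v. v \<approx> u \<longrightarrow> length v = length u \<longrightarrow> u \<sim> v)"
  using assms
proof (induction "length u" arbitrary: u rule: less_induct)
  case less
  show ?case
  proof (cases u rule: rev_cases)
    case Nil
    then show ?thesis by (simp add: reduced_def)
  next
    case (snoc u' t)
    have g': "good u'" using good_prefix less.prems snoc by blast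
    note IH' = less.hyps[OF _ g']
    have r': "reduced u'" and uniq': "\<And>v. v \<approx> u' \<Longrightarrow> length v = length u' \<Longrightarrow> u' \<sim> v"
      using IH' snoc by auto
    have l: "u' \<in> lists I" "t \<in> I" using good_in_lists[OF less.prems] snoc by auto
    have red: "reduced u"
    proof (rule ccontr)
      assume n: "\<not> reduced u"
      obtain x where x: "reduced x" "x \<approx> u" "length x \<le> length u"
        using reduced_exists good_in_lists[OF less.prems] by blast
      then have "length x \<noteq> length u" using n reduced_eqv[OF x(1) eqv_sym[OF x(2)]] by metis
      \<comment> \<open>Equivalent words have lengths of the same parity, so a strictly shorter one
        lacks at least two letters.\<close>
      then have len: "Suc (length x) \<le> length u'"
        using x eqv_even_length[OF x(2)] snoc
        by (metis Suc_leI even_Suc le_neq_implies_less length_append_singleton less_SucE)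
      have "x @ [t] \<approx> u' @ [t, t]" using eqv_ctxt[OF x(2), of "[]" "[t]"] snoc l by simp
      also have "\<dots> \<approx> u'" using square[of u' "[]" t] l by simp
      finally have xt: "x @ [t] \<approx> u'" .
      then have "length u' \<le> Suc (length x)" using r' unfolding reduced_def by fastforce
      then have "u' \<sim> x @ [t]" using uniq'[OF xt] len by simp
      then have "u \<sim> x @ [t, t]" using comm_ctxt[of u' "x @ [t]" "[]" "[t]"] snoc by simp
      then show False using good_no_square[OF less.prems, of x t "[]"] by simp
    qed
    moreover have "u \<sim> v" if v: "v \<approx> u" "length v = length u" for v
    proof -
      obtain v' s where vs: "v = v' @ [s]" using v(2) snoc by (cases v rule: rev_cases) auto
      have s: "s \<in> I" using eqv_lists(1)[OF v(1)] vs by simp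
      show ?thesis
      proof (cases "s = t")
        case True
        then have "v' \<approx> u'" using v(1) snoc vs cancel_right by blast
        then have "u' \<sim> v'" using uniq' v(2) snoc vs by simp
        then show ?thesis using comm_ctxt[of u' v' "[]" "[t]"] snoc vs True by simp
      next
        case False
        obtain k where k: "m s t = Suc (Suc k)"
          using off_diag[OF False] by (metis Suc_le_D numeral_2_eq_2 Suc_le_mono)
        obtain z where z: "z @ rev (alt t s (m s t)) \<approx> u" "length z + m s t = length u"
          using dihedral_suffix[OF red, of u' t v' s "m s t"] v snoc vs sym[of s t] l
            reduced_in_lists[OF red] by auto
        have "z @ rev (alt s t (Suc k)) \<approx> u'"
          using z(1) cancel_right[of "z @ rev (alt s t (Suc k))" "[t]" u'] snoc k by simp
        then have "u' \<sim> z @ rev (alt s t (Suc k))" using uniq' z(2) snoc k by simp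
        then have uz: "u \<sim> z @ rev (alt t s (m s t))"
          using comm_ctxt[of u' "z @ rev (alt s t (Suc k))" "[]" "[t]"] snoc k by simp
        have "\<not> 3 \<le> m s t"
        proof
          assume "3 \<le> m s t"
          then show False
            using uz good_no_braid[OF less.prems, of s t z "[]"] good_no_braid[OF less.prems, of t s z "[]"]
              rev_alt[of t s "m s t"] sym[of s t] by (auto split: if_splits)
        qed
        then have m2: "m s t = 2" using k by simp
        then have "u \<sim> z @ [s, t]" using uz by (simp add: numeral_2_eq_2)
        moreover have "commutation m (z @ [s, t] @ []) (z @ [t, s] @ [])"
          by (rule commutation.intros) fact
        ultimately have uz': "u \<sim> z @ [t, s]" by simp
        then have "good (z @ [t])" using good_prefix[of "z @ [t]" "[s]"] good_comm[OF less.prems] by simp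
        moreover have "v' \<approx> z @ [t]"
        proof (rule cancel_right)
          show "v' @ [s] \<approx> (z @ [t]) @ [s]"
            using v(1) vs comm_eqv[OF uz' good_in_lists[OF less.prems]] eqv_trans by simp
        qed
        ultimately have "z @ [t] \<sim> v'"
          using less.hyps[of "z @ [t]"] v(2) vs comm_length[OF uz'] by simp
        then have "z @ [t, s] \<sim> v" using comm_ctxt[of "z @ [t]" v' "[]" "[s]"] vs by simp
        then show ?thesis using uz' by simp
      qed
    qed
    ultimately show ?thesis by blast
  qed
qed

lemmas good_reduced = good_reduced_unique[THEN conjunct1]

lemma good_unique: "good u \<Longrightarrow> v \<approx> u \<Longrightarrow> length v = length u \<Longrightarrow> u \<sim> v"
  using good_reduced_unique by blast

lemma good_eqv_iff:
  assumes "good u" "good v"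
  shows "u \<approx> v \<longleftrightarrow> u \<sim> v"
proof
  assume uv: "u \<approx> v"
  then have "length u = length v"
    using good_reduced[OF assms(1)] good_reduced[OF assms(2)] eqv_sym
    unfolding reduced_def by (metis le_antisym)
  then show "u \<sim> v" using good_unique[OF assms(1) eqv_sym[OF uv]] by simp
qed (use comm_eqv good_in_lists[OF assms(1)] in blast)

section \<open>From words to group elements\<close>

abbreviation "cls \<equiv> cox_class I m"
abbreviation "W \<equiv> coxeter_group I m"

lemma cox_expressions_class:
  assumes "u \<in> lists I"
  shows "cox_expressions I m (cls u) = {v. v \<approx> u}"
proof -
  have "foldr (\<lambda>s x. cox_gen I m s \<otimes>\<^bsub>W\<^esub> x) v \<one>\<^bsub>W\<^esub> = cls v" if "v \<in> lists I" for v
    using that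
  proof (induction v)
    case Nil show ?case by (simp add: coxeter_group_def)
  qed (simp add: cox_gen_def cox_mult_class)
  then have "v \<in> cox_expressions I m (cls u) \<longleftrightarrow> v \<in> lists I \<and> v \<approx> u" for v
    unfolding cox_expressions_def using cox_class_eq_iff[of v I m u] by auto
  then show ?thesis using eqv_lists by blast
qed

lemma cox_length_class:
  assumes "reduced u"
  shows "cox_length I m (cls u) = length u"
  unfolding cox_length_def
proof (rule Least_equality)
  show "\<exists>v\<in>cox_expressions I m (cls u). length v = length u"
    using reduced_in_lists[OF assms] eqv_refl[of u] unfolding cox_expressions_class[OF reduced_in_lists[OF assms]] by blast
next
  fix k assume "\<exists>v\<in>cox_expressions I m (cls u). length v = k"
  then show "length u \<le> k"
    using assms reduced_in_lists[OF assms] by (auto simp: cox_expressions_class reduced_def)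
qed

lemma reduced_expressions_class:
  assumes "reduced u"
  shows "reduced_expressions I m (cls u) = {v. v \<approx> u \<and> length v = length u}"
  unfolding reduced_expressions_def cox_expressions_class[OF reduced_in_lists[OF assms]]
    cox_length_class[OF assms] by blast

lemma class_reduced:
  assumes "w \<in> carrier W"
  obtains u where "reduced u" "w = cls u"
proof -
  obtain u where u: "u \<in> lists I" "w = cls u" using assms by (auto simp: coxeter_group_def)
  then obtain v where "reduced v" "v \<approx> u" using reduced_exists by blast
  then show ?thesis using that[of v] u cox_class_eq_iff[of v I m u] eqv_lists by metis
qed

text \<open>A long braid in a reduced expression could be replaced by the braid starting with the
  other letter. The result is again reduced, but its restriction to the two letters differs, whereas
  commutations preserve this restriction. The converse is uniqueness of good words.\<close>

lemma fully_commutative_class: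
  assumes "reduced u"
  shows "fully_commutative I m (cls u) \<longleftrightarrow> good u"
proof
  assume fc: "fully_commutative I m (cls u)"
  have uniq: "v \<sim> v'" if "v \<approx> u" "length v = length u" "v' \<approx> u" "length v' = length u" for v v'
    using fc assms that unfolding fully_commutative_def by (auto simp: reduced_expressions_class)
  have *: "v \<noteq> x @ [s, s] @ y" "3 \<le> m s t \<Longrightarrow> v \<noteq> x @ alt s t (m s t) @ y"
    if "u \<sim> v" for v x y s t
  proof -
    have v: "v \<approx> u" "length v = length u" "v \<in> lists I"
      using comm_eqv[OF that reduced_in_lists[OF assms]] comm_length[OF that] eqv_sym eqv_lists by auto
    have rv: "reduced v" using reduced_eqv[OF assms] v by blast
    show "v \<noteq> x @ [s, s] @ y"
    proof
      assume e: "v = x @ [s, s] @ y"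
      then have "x @ y \<approx> v" using v square[of x y s] eqv_sym by simp
      then show False using rv e unfolding reduced_def by fastforce
    qed
    show "v \<noteq> x @ alt s t (m s t) @ y" if "3 \<le> m s t"
    proof
      assume e: "v = x @ alt s t (m s t) @ y"
      let ?v = "x @ alt t s (m s t) @ y"
      obtain k where k: "m s t = Suc (Suc k)" using \<open>3 \<le> m s t\<close> by (metis Suc_le_D numeral_3_eq_3 Suc_le_mono)
      have st: "s \<in> I" "t \<in> I" using v(3) e k by auto
      then have ne: "s \<noteq> t" using diag \<open>3 \<le> m s t\<close> by fastforce
      have "v \<approx> ?v"
        unfolding e by (rule eqv_ctxt[OF alt_eqv]) (use st v(3) e in auto)
      then have "v \<sim> ?v" by (intro uniq) (use v e in \<open>auto intro: eqv_sym eqv_trans\<close>)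
      then have "filter (\<lambda>x. x = s \<or> x = t) v = filter (\<lambda>x. x = s \<or> x = t) ?v"
        using comm_filter \<open>3 \<le> m s t\<close> by auto
      then show False using ne e k by simp
    qed
  qed
  then show "good u" using reduced_in_lists[OF assms] unfolding good_def by blast
next
  assume g: "good u"
  have "v \<sim> v'" if "v \<approx> u" "length v = length u" "v' \<approx> u" "length v' = length u" for v v'
    using good_unique[OF g] that comm_sym rtranclp_trans by metis
  then show "fully_commutative I m (cls u)"
    using assms unfolding fully_commutative_def by (auto simp: reduced_expressions_class)
qed

lemma good_rev:
  assumes "good u"
  shows "good (rev u)"
proof -
  have *: "v \<noteq> x @ [s, s] @ y" "3 \<le> m s t \<Longrightarrow> v \<noteq> x @ alt s t (m s t) @ y"
    if "rev u \<sim> v" for v x y s t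
  proof -
    have uv: "u \<sim> rev v" using comm_rev[OF that] by simp
    show "v \<noteq> x @ [s, s] @ y" using uv good_no_square[OF assms, of "rev y" s "rev x"] by auto
    show "3 \<le> m s t \<Longrightarrow> v \<noteq> x @ alt s t (m s t) @ y"
      using uv good_no_braid[OF assms, of s t "rev y" "rev x"] sym[of s t]
        good_no_braid[OF assms, of t s "rev y" "rev x"] rev_alt[of s t "m s t"] rev_alt[of t s "m s t"]
      by (auto split: if_splits)
  qed
  then show ?thesis using good_in_lists[OF assms] unfolding good_def by auto
qed

text \<open>Reversal represents the inverse, so the square is trivial iff
  \<open>u \<approx> rev u\<close>. Both words are good, and for good words equivalence is
  commutation equivalence.\<close>

lemma FC_involutions_eq: "FC_involutions I m = cls ` {u. good u \<and> u \<sim> rev u}"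
proof -
  have inv: "cls u \<otimes>\<^bsub>W\<^esub> cls u = \<one>\<^bsub>W\<^esub> \<longleftrightarrow> u \<sim> rev u" if g: "good u" for u
  proof -
    have l: "u \<in> lists I" using good_in_lists[OF g] .
    have "cls u \<otimes>\<^bsub>W\<^esub> cls u = \<one>\<^bsub>W\<^esub> \<longleftrightarrow> u @ u \<approx> []"
      using l by (subst cox_mult_class) (auto simp: coxeter_group_def cox_class_eq_iff)
    also have "\<dots> \<longleftrightarrow> u \<approx> rev u"
      using cancel_right[of u u "rev u"] eqv_ctxt[of u "rev u" "[]" u] rev_left[OF l] l
      by (metis append.left_neutral eqv_sym eqv_trans lists.Nil)
    finally show ?thesis using good_eqv_iff[OF g good_rev[OF g]] by simp
  qed
  show ?thesis
  proof (intro Set.set_eqI iffI)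
    fix w assume "w \<in> FC_involutions I m"
    then have w: "w \<in> carrier W" "fully_commutative I m w" "w \<otimes>\<^bsub>W\<^esub> w = \<one>\<^bsub>W\<^esub>"
      by (auto simp: FC_involutions_def)
    obtain u where u: "reduced u" "w = cls u" using class_reduced[OF w(1)] by blast
    then show "w \<in> cls ` {u. good u \<and> u \<sim> rev u}"
      using w inv fully_commutative_class[OF u(1)] by blast
  next
    fix w assume "w \<in> cls ` {u. good u \<and> u \<sim> rev u}"
    then obtain u where u: "good u" "u \<sim> rev u" "w = cls u" by blast
    moreover have "w \<in> carrier W" using u good_in_lists by (auto simp: coxeter_group_def)
    ultimately show "w \<in> FC_involutions I m"
      using inv fully_commutative_class[OF good_reduced[OF u(1)]] by (auto simp: FC_involutions_def)
  qed
qed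

lemma class_eq_iff: "good u \<Longrightarrow> good v \<Longrightarrow> cls u = cls v \<longleftrightarrow> u \<sim> v"
  using cox_class_eq_iff[OF good_in_lists, of u m v] good_eqv_iff[of u v] by simp

text \<open>If multiplying by \<open>s\<close> shortens \<open>u\<close> to \<open>v\<close>, then
  \<open>v @ [s]\<close> is another reduced expression of the same element, hence lies in the
  commutation class of \<open>u\<close>.\<close>

lemma right_descents_class:
  assumes "good u"
  shows "right_descents I m (cls u) = {s. \<exists>x. u \<sim> x @ [s]}"
proof -
  note r = good_reduced[OF assms]
  note l = good_in_lists[OF assms]
  have "s \<in> I \<and> cox_length I m (cls u \<otimes>\<^bsub>W\<^esub> cox_gen I m s) < length u \<longleftrightarrow> (\<exists>x. u \<sim> x @ [s])" for s
  proof
    assume s: "s \<in> I \<and> cox_length I m (cls u \<otimes>\<^bsub>W\<^esub> cox_gen I m s) < length u"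
    then have sI: "s \<in> I" by blast
    have us: "cls u \<otimes>\<^bsub>W\<^esub> cox_gen I m s = cls (u @ [s])"
      using sI l by (simp add: cox_gen_def cox_mult_class)
    obtain v where v: "reduced v" "v \<approx> u @ [s]"
      using reduced_exists[of "u @ [s]"] l sI by auto
    then have "cls (u @ [s]) = cls v" using cox_class_eq_iff[of v I m] reduced_in_lists by metis
    then have len: "length v < length u" using s us cox_length_class[OF v(1)] by simp
    have "v @ [s] \<approx> u @ [s, s]" using eqv_ctxt[OF v(2), of "[]" "[s]"] sI by simp
    also have "\<dots> \<approx> u" using square[of u "[]" s] l sI by simp
    finally have vs: "v @ [s] \<approx> u" .
    then have "length u \<le> length (v @ [s])" using r unfolding reduced_def by blast
    then show "\<exists>x. u \<sim> x @ [s]" using good_unique[OF assms vs] len by auto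
  next
    assume "\<exists>x. u \<sim> x @ [s]"
    then obtain x where x: "u \<sim> x @ [s]" by blast
    have ux: "u \<approx> x @ [s]" using comm_eqv[OF x l] .
    then have lx: "x \<in> lists I" "s \<in> I" using eqv_lists by fastforce+
    have "u @ [s] \<approx> x @ [s, s]" using eqv_ctxt[OF ux, of "[]" "[s]"] lx by simp
    also have "\<dots> \<approx> x" using square[of x "[]" s] lx by simp
    finally have "cls (u @ [s]) = cls x" using l lx by (simp add: cox_class_eq_iff)
    moreover have "reduced x" using good_reduced good_prefix good_comm[OF assms x] by blast
    ultimately show "s \<in> I \<and> cox_length I m (cls u \<otimes>\<^bsub>W\<^esub> cox_gen I m s) < length u"
      using l lx comm_length[OF x] by (simp add: cox_gen_def cox_mult_class cox_length_class)
  qed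
  then show ?thesis by (simp add: right_descents_def cox_length_class[OF r])
qed

end

section \<open>Fully commutative words in type \<open>B\<close>\<close>

text \<open>The action on \<open>int\<close> by signed permutations of \<open>{1..n}\<close> (sign change at \<open>n\<close>) shows that the products
  of two generators have the orders prescribed by \<^const>\<open>B_matrix\<close>.\<close>

definition bgen :: "nat \<Rightarrow> nat \<Rightarrow> int \<Rightarrow> int" where
  "bgen n i x = (if i = n then (if \<bar>x\<bar> = int n then - x else x)
     else if x = int i then int i + 1 else if x = int i + 1 then int i
     else if x = - int i then - int i - 1 else if x = - int i - 1 then - int i else x)"

definition bact :: "nat \<Rightarrow> nat list \<Rightarrow> int \<Rightarrow> int" where
  "bact n u = foldr (\<lambda>i f. bgen n i \<circ> f) u id"

lemma bact_append: "bact n (u @ v) = bact n u \<circ> bact n v"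
  by (induction u) (auto simp: bact_def)

lemma bgen_involution: "0 < s \<Longrightarrow> bgen n s (bgen n s x) = x"
  by (auto simp: bgen_def)

text \<open>The generator \<open>s\<close> moves only four points, each fixed by \<open>t\<close>,
  and the complement of these points is stable under \<open>t\<close>.\<close>

lemma bgen_commute:
  assumes "0 < s" "Suc s < t" "t \<le> n"
  shows "bgen n s (bgen n t x) = bgen n t (bgen n s x)"
proof -
  have s: "bgen n s y = y" if "y \<notin> {int s, int s + 1, - int s, - int s - 1}" for y
    using that assms by (auto simp: bgen_def)
  have t: "bgen n t y = y" if "y \<in> {int s, int s + 1, - int s, - int s - 1}" for y
    using that assms by (auto simp: bgen_def)
  have s': "bgen n s y \<in> {int s, int s + 1, - int s, - int s - 1}"
    if "y \<in> {int s, int s + 1, - int s, - int s - 1}" for y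
    using that assms by (auto simp: bgen_def)
  have t': "bgen n t y \<notin> {int s, int s + 1, - int s, - int s - 1}"
    if "y \<notin> {int s, int s + 1, - int s, - int s - 1}" for y
    using t that bgen_involution[of t n y] assms
    by (metis bgen_involution less_trans Suc_lessD)
  show ?thesis
    by (cases "x \<in> {int s, int s + 1, - int s, - int s - 1}") (metis s t s' t')+
qed

lemma bgen_braid:
  assumes "0 < s" "Suc s < n"
  shows "bgen n s (bgen n (Suc s) (bgen n s x)) = bgen n (Suc s) (bgen n s (bgen n (Suc s) x))"
proof -
  consider "x = int s" | "x = int s + 1" | "x = int s + 2" | "x = - int s" | "x = - int s - 1"
    | "x = - int s - 2" | "bgen n s x = x \<and> bgen n (Suc s) x = x"
    using assms by (force simp: bgen_def)
  then show ?thesis using assms by cases (simp_all add: bgen_def)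
qed

lemma bgen_braid4:
  assumes "0 < s"
  shows "bgen (Suc s) s (bgen (Suc s) (Suc s) (bgen (Suc s) s (bgen (Suc s) (Suc s) x))) =
    bgen (Suc s) (Suc s) (bgen (Suc s) s (bgen (Suc s) (Suc s) (bgen (Suc s) s x)))"
proof -
  consider "x = int s" | "x = int s + 1" | "x = - int s" | "x = - int s - 1"
    | "bgen (Suc s) s x = x \<and> bgen (Suc s) (Suc s) x = x"
    by (force simp: bgen_def)
  then show ?thesis using assms by cases (simp_all add: bgen_def)
qed

lemma B_matrix_cases:
  assumes "s \<in> {1..n}" "t \<in> {1..n}"
  obtains "s = t" | "Suc s < t \<or> Suc t < s" | "t = Suc s" "t < n" | "s = Suc t" "s < n"
    | "t = Suc s" "t = n" | "s = Suc t" "s = n"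
proof -
  consider "s = t" | "Suc s < t" | "Suc t < s" | "t = Suc s" | "s = Suc t" by linarith
  then show ?thesis
    using assms that by cases (auto simp: le_less)
qed

lemma bact_relator:
  assumes "s \<in> {1..n}" "t \<in> {1..n}"
  shows "bact n (alt s t (2 * B_matrix n s t)) = id"
proof -
  have pos: "0 < s" "0 < t" "s \<le> n" "t \<le> n" using assms by auto
  note inv = bgen_involution[OF pos(1), of n] bgen_involution[OF pos(2), of n]
  from assms show ?thesis
  proof (cases rule: B_matrix_cases)
    case 2
    then have "bgen n s (bgen n t x) = bgen n t (bgen n s x)" for x
      using bgen_commute[of s t n x] bgen_commute[of t s n x] pos by auto
    with 2 show ?thesis using inv
      by (auto simp: fun_eq_iff B_matrix_def bact_def numeral_eq_Suc)
  next
    case 3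
    then have "B_matrix n s t = 3" by (simp add: B_matrix_def)
    then show ?thesis using 3 inv bgen_braid[of s n] pos
      by (simp add: fun_eq_iff bact_def numeral_eq_Suc)
  next
    case 4
    then have "B_matrix n s t = 3" by (simp add: B_matrix_def)
    then show ?thesis using 4 inv bgen_braid[of t n] pos
      by (simp add: fun_eq_iff bact_def numeral_eq_Suc)
  next
    case 5
    then have "B_matrix n s t = 4" by (simp add: B_matrix_def)
    then show ?thesis using 5 inv bgen_braid4[of s] pos
      by (simp add: fun_eq_iff bact_def numeral_eq_Suc)
  next
    case 6
    then have "B_matrix n s t = 4" by (simp add: B_matrix_def)
    then show ?thesis using 6 inv bgen_braid4[of t] pos
      by (simp add: fun_eq_iff bact_def numeral_eq_Suc)
  qed (use inv in \<open>auto simp: fun_eq_iff B_matrix_def bact_def numeral_eq_Suc\<close>)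
qed

lemma bact_cong: "cox_eq {1..n} (B_matrix n) u v \<Longrightarrow> bact n u = bact n v"
proof (induction rule: cox_eq.induct)
  case (relator u v s t)
  then show ?case using bact_relator[of s n t] by (simp add: bact_append alt_double)
qed auto

text \<open>Each witness lies on a cycle of length \<open>B_matrix n s t\<close> of the product of
  the two generators, so no smaller positive power fixes it. For label \<open>4\<close> the cycle
  runs through the two largest indices and their negatives.\<close>

lemma bact_alt_neq_id:
  assumes "s \<in> {1..n}" "t \<in> {1..n}" "0 < j" "j < B_matrix n s t"
  shows "bact n (alt s t (2 * j)) \<noteq> id"
proof -
  have "\<exists>x. bact n (alt s t (2 * j)) x \<noteq> x"
    using assms(1,2)
  proof (cases rule: B_matrix_cases)
    case 1
    then show ?thesis using assms by (simp add: B_matrix_def)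
  next
    case 2
    then have "j = 1" using assms by (auto simp: B_matrix_def)
    then show ?thesis using 2 assms
      by (intro exI[of _ "int s"]) (auto simp: bact_def bgen_def numeral_eq_Suc)
  next
    case 3
    then have "j = 1 \<or> j = 2" using assms by (auto simp: B_matrix_def)
    then show ?thesis using 3 assms
      by (intro exI[of _ "int s"]) (auto simp: bact_def bgen_def numeral_eq_Suc)
  next
    case 4
    then have "j = 1 \<or> j = 2" using assms by (auto simp: B_matrix_def)
    then show ?thesis using 4 assms
      by (intro exI[of _ "int s + 1"]) (auto simp: bact_def bgen_def numeral_eq_Suc)
  next
    case 5
    then have "j = 1 \<or> j = 2 \<or> j = 3" using assms by (auto simp: B_matrix_def)
    then show ?thesis using 5 assms
      by (intro exI[of _ "int n"]) (auto simp: bact_def bgen_def numeral_eq_Suc)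
  next
    case 6
    then have "j = 1 \<or> j = 2 \<or> j = 3" using assms by (auto simp: B_matrix_def)
    then show ?thesis using 6 assms
      by (intro exI[of _ "int n"]) (auto simp: bact_def bgen_def numeral_eq_Suc)
  qed
  then show ?thesis by (metis id_apply)
qed

lemma coxeter_system_B: "coxeter_system {1..n} (B_matrix n)"
proof
  fix s t :: nat and j
  assume "s \<in> {1..n}" "t \<in> {1..n}" "0 < j" "j < B_matrix n s t"
  then show "\<not> cox_eq {1..n} (B_matrix n) (alt s t (2 * j)) []"
    using bact_alt_neq_id[of s n t j] bact_cong[of n "alt s t (2 * j)" "[]"] by (auto simp: bact_def)
qed (auto simp: B_matrix_def max.commute)

interpretation B: coxeter_system "{1..n}" "B_matrix n" for n
  by (rule coxeter_system_B)

section \<open>Restrictions to pairs of adjacent letters\<close>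

abbreviation comm_B :: "nat \<Rightarrow> nat list \<Rightarrow> nat list \<Rightarrow> bool" where
  "comm_B n \<equiv> (commutation (B_matrix n))\<^sup>*\<^sup>*"

text \<open>The index \<open>0\<close> is used as well: over the letters \<open>1\<close> to
  \<open>n\<close>, \<open>pr 0\<close> keeps just the letter \<open>1\<close>. Thus every letter
  \<open>s\<close> occurs in the restriction with index \<open>s - 1\<close>, also when
  \<open>n = 1\<close>.\<close>

abbreviation pr :: "nat \<Rightarrow> nat list \<Rightarrow> nat list" where
  "pr i u \<equiv> filter (\<lambda>x. x = i \<or> x = Suc i) u"

abbreviation nb :: "nat \<Rightarrow> nat \<Rightarrow> bool" where
  "nb s x \<equiv> Suc x = s \<or> x = Suc s"

lemma B_matrix_commute: "x \<noteq> s \<Longrightarrow> \<not> nb s x \<Longrightarrow> B_matrix n s x = 2"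
  by (auto simp: B_matrix_def)

lemma pr_comm: "comm_B n u v \<Longrightarrow> pr i u = pr i v"
  by (rule B.comm_filter[where n = n]) (auto simp: B_matrix_def)

lemma comm_front:
  assumes "s \<notin> set y" "\<And>x. x \<in> set y \<Longrightarrow> \<not> nb s x"
  shows "comm_B n (x @ [s] @ y @ z) (x @ y @ [s] @ z)"
proof (rule B.comm_move)
  show "B_matrix n s b = 2" if "b \<in> set y" for b
    using assms(1) assms(2)[OF that] that by (metis B_matrix_commute)
qed

lemma comm_back:
  assumes "s \<notin> set y" "\<And>x. x \<in> set y \<Longrightarrow> \<not> nb s x"
  shows "comm_B n (x @ y @ [s] @ z) (x @ [s] @ y @ z)"
  by (rule B.comm_sym[OF comm_front[OF assms]])

text \<open>Let \<open>a\<close> be the first letter of \<open>u\<close>. No neighbour of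
  \<open>a\<close> precedes the first \<open>a\<close> in \<open>v\<close>, since otherwise some
  restriction of \<open>v\<close> would not begin with \<open>a\<close>. So this \<open>a\<close>
  can be moved to the front of \<open>v\<close> and cancelled.\<close>

lemma comm_B_iff:
  assumes "u \<in> lists {1..n}" "v \<in> lists {1..n}"
  shows "comm_B n u v \<longleftrightarrow> (\<forall>i<n. pr i u = pr i v)"
proof
  assume eq: "\<forall>i<n. pr i u = pr i v"
  have "set u \<subseteq> {1..n}" "set v \<subseteq> {1..n}" using assms by auto
  then show "comm_B n u v" using eq
  proof (induction u arbitrary: v)
    case Nil
    have False if "s \<in> set v" for s
    proof -
      have "s \<in> {1..n}" using Nil.prems that by auto
      then have "s \<in> set (pr (s - 1) v)" "s - 1 < n" using that by auto
      moreover have "pr (s - 1) v = []" using Nil.prems \<open>s - 1 < n\<close> by (metis filter.simps(1))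
      ultimately show False by (metis empty_iff empty_set)
    qed
    then have "v = []" by (cases v) auto
    then show ?case by simp
  next
    case (Cons a u)
    have a: "1 \<le> a" "a \<le> n" using Cons.prems by auto
    then have "a \<in> set (pr (a - 1) (a # u))" "a - 1 < n" by auto
    then have "a \<in> set v" using Cons.prems(3) by (metis filter_is_subset subsetD)
    then obtain x y where v: "v = x @ a # y" "a \<notin> set x" by (meson split_list_first)
    have nbx: "\<not> nb a b" if b: "b \<in> set x" for b
    proof
      assume nb: "nb a b"
      define i where "i = (if Suc b = a then b else a)"
      have i: "i < n" "a = i \<or> a = Suc i" "b = i \<or> b = Suc i" "b \<noteq> a"
      proof -
      have "b \<in> {1..n}" using b v(1) Cons.prems(2) by auto
      then show "i < n" "a = i \<or> a = Suc i" "b = i \<or> b = Suc i" "b \<noteq> a"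
        using nb a by (auto simp: i_def split: if_splits)
    qed
      have "pr i (a # u) = pr i v" using Cons.prems(3) i by blast
      then have "a # pr i u = pr i x @ a # pr i y" using i v by auto
      then have "pr i x = []" using v(2) by (cases "pr i x") (auto simp: filter_eq_Cons_iff)
      then show False using b i by (auto simp: filter_empty_conv)
    qed
    then have c: "comm_B n v (a # x @ y)" using comm_back[of a x n "[]" y] v by simp
    have "pr i u = pr i (x @ y)" if "i < n" for i
    proof -
      have "pr i (a # u) = pr i (a # x @ y)" using Cons.prems(3) pr_comm[OF c] that by simp
      then show ?thesis by (auto split: if_splits)
    qed
    then have "comm_B n u (x @ y)" using Cons.IH[of "x @ y"] Cons.prems v by simp
    then have "comm_B n (a # u) (a # x @ y)" using B.comm_ctxt[of n u "x @ y" "[a]" "[]"] by simp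
    then show ?case using B.comm_sym[OF c] by (rule rtranclp_trans)
  qed
qed (use pr_comm in blast)

lemma count_list_pr [simp]:
  "count_list (pr i u) i = count_list u i"
  "count_list (pr i u) (Suc i) = count_list u (Suc i)"
  by (induction u) auto

lemma count_list_ge_2:
  assumes "2 \<le> count_list y i"
  obtains a b c where "y = a @ [i] @ b @ [i] @ c" "i \<notin> set b"
proof -
  have "i \<in> set y" using assms by (metis count_notin not_numeral_le_zero)
  then obtain a r where y: "y = a @ i # r" "i \<notin> set a" by (meson split_list_first)
  then have "i \<in> set r" using assms by (metis count_list.simps(2) count_list_append count_notin
    One_nat_def Suc_1 add.left_neutral not_less_eq_eq order_refl)
  then obtain b c where "r = b @ i # c" "i \<notin> set b" by (meson split_list_first)
  then show ?thesis using that y by simp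
qed

lemma filter_eq_append_two:
  assumes "filter P u = x @ [s, t] @ y"
  obtains a b c where "u = a @ [s] @ b @ [t] @ c" "filter P a = x" "\<forall>z\<in>set b. \<not> P z" "filter P c = y"
    "P s" "P t"
  using assms
proof (induction x arbitrary: u thesis)
  case Nil
  from Nil.prems(2) obtain a r where a: "u = a @ s # r" "\<forall>z\<in>set a. \<not> P z" "P s" "t # y = filter P r"
    by (auto simp: filter_eq_Cons_iff)
  from a(4) obtain b c where b: "r = b @ t # c" "\<forall>z\<in>set b. \<not> P z" "P t" "y = filter P c"
    by (auto simp: Cons_eq_filter_iff)
  show ?case using Nil.prems(1)[of a b c] a b by (simp add: filter_empty_conv)
next
  case (Cons d x)
  from Cons.prems(2) obtain e r where e: "u = e @ d # r" "\<forall>z\<in>set e. \<not> P z" "P d" "filter P r = x @ [s, t] @ y"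
    by (auto simp: filter_eq_Cons_iff)
  obtain a b c where "r = a @ [s] @ b @ [t] @ c" "filter P a = x" "\<forall>z\<in>set b. \<not> P z" "filter P c = y"
    "P s" "P t"
    using Cons.IH[OF _ e(4)] by blast
  then show ?case using Cons.prems(1)[of "e @ d # a" b c] e by (simp add: filter_empty_conv)
qed

lemma filter_eq_singletonE:
  assumes "filter P b = [t]"
  obtains b1 b2 where "b = b1 @ t # b2" "\<forall>x\<in>set b1. \<not> P x" "\<forall>x\<in>set b2. \<not> P x" "P t"
proof -
  obtain b1 b2 where "b = b1 @ t # b2" "\<forall>x\<in>set b1. \<not> P x" "P t" "[] = filter P b2"
    using assms by (auto simp: filter_eq_Cons_iff)
  moreover from this(4) have "\<forall>x\<in>set b2. \<not> P x" by (metis filter_empty_conv)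
  ultimately show ?thesis using that by blast
qed

section \<open>Successive occurrences of a letter in a good word\<close>

text \<open>Letters that are not neighbours of \<open>s\<close> can be moved out from between the
  two \<open>s\<close>. Without a neighbour a square remains, with a single neighbour of label
  \<open>3\<close> a braid.\<close>

lemma good_between:
  assumes "B.good n (x @ [s] @ b @ [s] @ z)" "s \<notin> set b"
  shows "filter (nb s) b \<noteq> []" and "B_matrix n s t = 3 \<Longrightarrow> filter (nb s) b \<noteq> [t]"
proof -
  show "filter (nb s) b \<noteq> []"
  proof
    assume "filter (nb s) b = []"
    then have "comm_B n (x @ [s] @ b @ [s] @ z) (x @ b @ [s] @ [s] @ z)"
      using assms by (intro comm_front) (auto simp: filter_empty_conv)
    then show False using B.good_no_square[OF assms(1), of "x @ b" s z] by simp
  qed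
  show "filter (nb s) b \<noteq> [t]" if m: "B_matrix n s t = 3"
  proof
    assume "filter (nb s) b = [t]"
    then obtain b1 b2 where b: "b = b1 @ t # b2" "\<forall>x\<in>set b1. \<not> nb s x" "\<forall>x\<in>set b2. \<not> nb s x"
      by (rule filter_eq_singletonE)
    have "comm_B n (x @ [s] @ b1 @ ([t] @ b2 @ [s] @ z)) (x @ b1 @ [s] @ ([t] @ b2 @ [s] @ z))"
      using b assms(2) by (intro comm_front) auto
    moreover have "comm_B n ((x @ b1 @ [s, t]) @ b2 @ [s] @ z) ((x @ b1 @ [s, t]) @ [s] @ b2 @ z)"
      using b assms(2) by (intro comm_back) auto
    ultimately have "comm_B n (x @ [s] @ b @ [s] @ z) ((x @ b1) @ alt s t (B_matrix n s t) @ (b2 @ z))"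
      using m b by (simp add: numeral_eq_Suc)
    then show False using B.good_no_braid[OF assms(1), of s t "x @ b1" "b2 @ z"] m by simp
  qed
qed

text \<open>The four displayed letters can be brought together by commutations, which gives the
  braid of length \<open>4\<close>.\<close>

lemma good_no_4_chain:
  assumes "B.good (Suc p) (x @ [p] @ y1 @ [Suc p] @ y2 @ [p] @ y3 @ [Suc p] @ z)"
    and "\<forall>b\<in>set y1 \<union> set y2. \<not> nb p b \<and> b \<noteq> p" "\<forall>b\<in>set y3. b \<noteq> p \<and> b \<noteq> Suc p"
  shows False
proof -
  let ?n = "Suc p"
  have m4: "B_matrix ?n p ?n = 4" by (simp add: B_matrix_def)
  have nn: "Suc ?n \<notin> set y2 \<union> set y3"
    using B.good_in_lists[OF assms(1)] by auto
  have "comm_B ?n (x @ [p] @ y1 @ ([?n] @ y2 @ [p] @ y3 @ [?n] @ z))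
      (x @ y1 @ [p] @ ([?n] @ y2 @ [p] @ y3 @ [?n] @ z))"
    by (rule comm_front) (use assms in auto)
  also have "comm_B ?n ((x @ y1 @ [p, ?n]) @ y2 @ [p] @ (y3 @ [?n] @ z))
      ((x @ y1 @ [p, ?n]) @ [p] @ y2 @ (y3 @ [?n] @ z))"
    by (rule comm_back) (use assms in auto)
  then have "comm_B ?n (x @ y1 @ [p] @ ([?n] @ y2 @ [p] @ y3 @ [?n] @ z))
      ((x @ y1 @ [p, ?n, p]) @ (y2 @ y3) @ [?n] @ z)"
    by simp
  also have "comm_B ?n ((x @ y1 @ [p, ?n, p]) @ (y2 @ y3) @ [?n] @ z)
      ((x @ y1 @ [p, ?n, p]) @ [?n] @ (y2 @ y3) @ z)"
    by (rule comm_back) (use assms nn in auto)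
  also have "\<dots> = (x @ y1) @ alt p ?n (B_matrix ?n p ?n) @ (y2 @ y3 @ z)"
    by (simp add: m4 numeral_eq_Suc)
  finally show False
    using B.good_no_braid[OF assms(1), of p ?n "x @ y1" "y2 @ y3 @ z"] m4 by simp
qed

lemma filter_eq_replicate_count: "filter (\<lambda>x. x = i) y = replicate (count_list y i) i"
  by (induction y) auto

text \<open>Between two successive occurrences of \<open>i\<close> without \<open>i + 1\<close> in between there would be two
  occurrences of \<open>i - 1\<close> without \<open>i\<close>, and so on down to the missing letter \<open>0\<close>.\<close>

lemma good_count_le_1:
  assumes "B.good n u" "i < n" "sublist y u" "Suc i \<notin> set y"
  shows "count_list y i \<le> 1"
  using assms(2-)
proof (induction i arbitrary: y)
  case 0
  have "0 \<notin> set y" using B.good_in_lists[OF assms(1)] set_mono_sublist[OF 0(2)] by fastforce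
  then show ?case by simp
next
  case (Suc i)
  show ?case
  proof (rule ccontr)
    assume "\<not> ?thesis"
    then have "2 \<le> count_list y (Suc i)" by simp
    then obtain a b c where y: "y = a @ [Suc i] @ b @ [Suc i] @ c" "Suc i \<notin> set b"
      by (rule count_list_ge_2)
    obtain p q where u: "u = p @ y @ q" using Suc.prems(2) by (auto simp: sublist_def)
    have g: "B.good n ((p @ a) @ [Suc i] @ b @ [Suc i] @ (c @ q))" using assms(1) u y by simp
    have "sublist b u" unfolding sublist_def
      by (intro exI[of _ "p @ a @ [Suc i]"] exI[of _ "[Suc i] @ c @ q"]) (simp add: u y)
    then have "count_list b i \<le> 1" using Suc.IH[of b] Suc.prems y(2) by simp
    moreover have "filter (nb (Suc i)) b = filter (\<lambda>x. x = i) b"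
      using Suc.prems(3) y by (intro filter_cong) auto
    ultimately have "filter (nb (Suc i)) b = [] \<or> filter (nb (Suc i)) b = [i]"
      unfolding filter_eq_replicate_count by (cases "count_list b i") auto
    moreover have "B_matrix n (Suc i) i = 3" using Suc.prems(1) by (simp add: B_matrix_def)
    ultimately show False using good_between(1)[OF g y(2)] good_between(2)[OF g y(2), of i] by blast
  qed
qed

lemma good_pr_no_square:
  assumes "B.good n u" "i < n"
  shows "\<not> sublist [i, i] (pr i u)"
proof
  assume "sublist [i, i] (pr i u)"
  then obtain x y where "pr i u = x @ [i, i] @ y" by (auto simp: sublist_def)
  then obtain a b c where u: "u = a @ [i] @ b @ [i] @ c" "\<forall>z\<in>set b. \<not> (z = i \<or> z = Suc i)"
    by (rule filter_eq_append_two) blast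
  have "sublist ([i] @ b @ [i]) u" unfolding sublist_def
    by (intro exI[of _ a] exI[of _ c]) (simp add: u)
  then have "count_list ([i] @ b @ [i]) i \<le> 1"
    by (rule good_count_le_1[OF assms]) (use u in auto)
  then show False by simp
qed

lemma good_pr_no_square_last:
  assumes "B.good n u" "n = Suc p"
  shows "\<not> sublist [n, n] (pr p u)"
proof
  assume "sublist [n, n] (pr p u)"
  then obtain x y where "pr p u = x @ [n, n] @ y" by (auto simp: sublist_def)
  then obtain a b c where u: "u = a @ [n] @ b @ [n] @ c" "\<forall>z\<in>set b. \<not> (z = p \<or> z = Suc p)"
    by (rule filter_eq_append_two) blast
  have "Suc n \<notin> set b" using B.good_in_lists[OF assms(1)] u by auto
  then have "filter (nb n) b = []" using u assms(2) by (auto simp: filter_empty_conv)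
  then show False using good_between(1)[of n a n b c] assms u by auto
qed

text \<open>This is the restriction to the letters \<open>s\<close> and \<open>s + 1\<close> of the
  word that climbs from \<open>s\<close> to \<open>n\<close> and descends back to
  \<open>s\<close>.\<close>

definition chain_pr :: "nat \<Rightarrow> nat \<Rightarrow> nat list" where
  "chain_pr n s = (if Suc s = n then [s, n, s] else [s, Suc s, Suc s, s])"

text \<open>Without \<open>p - 1\<close> between the two \<open>p\<close>, some \<open>Suc p\<close>
  must separate them, and a second one would form a square with the first. A further
  \<open>p\<close> or \<open>Suc p\<close> in \<open>z\<close> would give two unseparated
  \<open>p\<close> or the braid of length \<open>4\<close>.\<close>

lemma good_peak_right:
  assumes g: "B.good (Suc p) (x @ [p] @ y @ [p] @ z)" and y: "\<forall>b\<in>set y. b \<noteq> p \<and> Suc b \<noteq> p"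
  shows "pr p y = [Suc p] \<and> pr p z = []"
proof -
  let ?n = "Suc p" and ?u = "x @ [p] @ y @ [p] @ z"
  have py: "pr p y = filter (\<lambda>b. b = ?n) y" using y by (intro filter_cong) auto
  have "filter (nb p) y \<noteq> []" by (rule good_between(1)[OF g]) (use y in auto)
  then have "?n \<in> set y" using y by (auto simp: filter_empty_conv)
  moreover have "\<not> 2 \<le> count_list y ?n"
  proof
    assume "2 \<le> count_list y ?n"
    then obtain k where "count_list y ?n = Suc (Suc k)" by (metis Suc_le_D numeral_2_eq_2 Suc_le_mono)
    then have "pr p ?u = (pr p x @ [p]) @ [?n, ?n] @ (replicate k ?n @ [p] @ pr p z)"
      using py by (simp add: filter_eq_replicate_count)
    then have "sublist [?n, ?n] (pr p ?u)" unfolding sublist_def by blast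
    then show False using good_pr_no_square_last[OF g HOL.refl] by blast
  qed
  ultimately have "count_list y ?n = 1" by (metis One_nat_def Suc_1 count_list_0_iff not_less_eq_eq le_Suc_eq le_zero_eq)
  then have pry: "pr p y = [?n]" using py by (simp add: filter_eq_replicate_count)
  then obtain y1 y2 where y12: "y = y1 @ ?n # y2" "\<forall>b\<in>set y1. b \<noteq> ?n" "\<forall>b\<in>set y2. b \<noteq> ?n"
    unfolding py by (elim filter_eq_singletonE)
  have "pr p z = []"
  proof (rule ccontr)
    assume "pr p z \<noteq> []"
    then obtain c r where c: "pr p z = c # r" by (cases "pr p z") auto
    then obtain z1 z2 where z: "z = z1 @ c # z2" "\<forall>b\<in>set z1. \<not> (b = p \<or> b = ?n)" "c = p \<or> c = ?n"
      by (auto simp: filter_eq_Cons_iff)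
    from z(3) show False
    proof
      assume "c = p"
      then have "pr p ?u = (pr p x @ [p] @ pr p y) @ [p, p] @ r" using c by simp
      then have "sublist [p, p] (pr p ?u)" unfolding sublist_def by blast
      then show False using good_pr_no_square[OF g] by blast
    next
      assume cn: "c = ?n"
      show False
        by (rule good_no_4_chain[of p x y1 y2 z1 z2]) (use g y y12 z cn in auto)
    qed
  qed
  with pry show ?thesis by simp
qed

lemma good_peak_last:
  assumes g: "B.good (Suc p) (x @ [p] @ y @ [p] @ z)" and y: "\<forall>b\<in>set y. b \<noteq> p \<and> Suc b \<noteq> p"
  shows "pr p (x @ [p] @ y @ [p] @ z) = [p, Suc p, p]"
proof -
  have "B.good (Suc p) (rev z @ [p] @ rev y @ [p] @ rev x)" using B.good_rev[OF g] by simp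
  then have "pr p (rev x) = []" using good_peak_right[of p "rev z" "rev y" "rev x"] y by simp
  then have "pr p x = []" by (simp flip: rev_filter)
  then show ?thesis using good_peak_right[OF g y] by simp
qed

text \<open>Induction downwards from the edge with label \<open>4\<close>. Two successive
  \<open>?s\<close> without the smaller neighbour in between enclose at least two \<open>?t\<close>,
  since one would form a braid of length \<open>3\<close>. Two successive ones among these satisfy
  the same hypothesis one letter higher.\<close>

lemma good_peak:
  assumes g: "B.good n u" and "Suc j < n" "sublist [Suc j, Suc j] (pr j u)"
  shows "pr (Suc j) u = chain_pr n (Suc j)"
  using assms(2-)
proof (induction "n - j" arbitrary: j)
  case (Suc d)
  let ?s = "Suc j"
  obtain p q where "pr j u = p @ [?s, ?s] @ q" using Suc.prems(2) by (auto simp: sublist_def)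
  then obtain x y z where u: "u = x @ [?s] @ y @ [?s] @ z" "\<forall>b\<in>set y. \<not> (b = j \<or> b = ?s)"
    by (rule filter_eq_append_two) blast
  show ?case
  proof (cases "Suc ?s = n")
    case True
    then show ?thesis using good_peak_last[of ?s x y z] g u by (auto simp: chain_pr_def)
  next
    case False
    let ?t = "Suc ?s"
    have tn: "?t < n" using False Suc.prems by simp
    have g': "B.good n (x @ [?s] @ y @ [?s] @ z)" using g u by simp
    have f: "filter (nb ?s) y = replicate (count_list y ?t) ?t"
      unfolding filter_eq_replicate_count[symmetric] using u by (intro filter_cong) auto
    have m: "B_matrix n ?s ?t = 3" using tn by (simp add: B_matrix_def)
    have sy: "?s \<notin> set y" using u by auto
    have ct: "2 \<le> count_list y ?t"
    proof (rule ccontr)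
      assume "\<not> ?thesis"
      then have "count_list y ?t = 0 \<or> count_list y ?t = 1" by linarith
      then show False using good_between(1)[OF g' sy] good_between(2)[OF g' sy, of ?t] f m by auto
    qed
    then obtain a b c where y: "y = a @ [?t] @ b @ [?t] @ c" "?t \<notin> set b"
      by (rule count_list_ge_2)
    have "pr ?s b = []" using y u by (auto simp: filter_empty_conv)
    then have "pr ?s u = (pr ?s x @ [?s] @ pr ?s a) @ [?t, ?t] @ (pr ?s c @ [?s] @ pr ?s z)"
      using u y by simp
    then have "sublist [?t, ?t] (pr ?s u)" unfolding sublist_def by blast
    then have "pr ?t u = chain_pr n ?t" using Suc.hyps(1)[of ?s] Suc.hyps(2) tn by simp
    \<comment> \<open>Both shapes of \<open>chain_pr n ?t\<close> contain \<open>?t\<close> twice,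
      so all occurrences of \<open>?t\<close> lie in \<open>y\<close>. The parts around
      \<open>y\<close> are then free of \<open>?t\<close>, and \<open>good_count_le_1\<close>
      excludes further \<open>?s\<close> there.\<close>
    then have "count_list u ?t = 2" using count_list_pr(1)[of ?t u] by (auto simp: chain_pr_def split: if_splits)
    then have cy: "count_list y ?t = 2" and xz: "?t \<notin> set x" "?t \<notin> set z"
      using ct u(1) by (auto simp: count_list_0_iff[symmetric] simp del: count_list_0_iff)
    have "sublist (x @ [?s]) u" "sublist ([?s] @ z) u"
      unfolding sublist_def
      by (rule exI[of _ "[]"], rule exI[of _ "y @ [?s] @ z"], simp add: u,
          rule exI[of _ "x @ [?s] @ y"], rule exI[of _ "[]"], simp add: u)
    then have "count_list (x @ [?s]) ?s \<le> 1" "count_list ([?s] @ z) ?s \<le> 1"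
      using good_count_le_1[OF g Suc.prems(1), of "x @ [?s]"]
        good_count_le_1[OF g Suc.prems(1), of "[?s] @ z"] xz by simp_all
    then have "?s \<notin> set x" "?s \<notin> set z" by (auto simp: count_list_0_iff)
    then have "pr ?s x = []" "pr ?s z = []" using xz by (auto simp: filter_empty_conv)
    moreover have "pr ?s y = filter (nb ?s) y" using u by (intro filter_cong) auto
    ultimately show ?thesis using u(1) f cy False by (simp add: chain_pr_def numeral_2_eq_2)
  qed
qed simp

section \<open>Good words in terms of their restrictions\<close>

text \<open>The last condition propagates: except for the last pair,
  \<open>chain_pr n (Suc j)\<close> again contains a square of its larger letter, so one such square
  determines all higher restrictions.\<close>

definition proper :: "nat \<Rightarrow> nat list \<Rightarrow> bool" where
  "proper n u \<longleftrightarrow> u \<in> lists {1..n} \<and> (\<forall>i<n. \<not> sublist [i, i] (pr i u)) \<and> \<not> sublist [n, n] (pr (n - 1) u) \<and>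
     (\<forall>j. Suc j < n \<longrightarrow> sublist [Suc j, Suc j] (pr j u) \<longrightarrow> pr (Suc j) u = chain_pr n (Suc j))"

lemma sublist_filter: "sublist xs ys \<Longrightarrow> sublist (filter P xs) (filter P ys)"
  unfolding sublist_def by (metis filter_append)

text \<open>The conditions depend only on the restrictions, so they hold for every \<open>v\<close>
  in the class. A braid beginning with the smaller letter \<open>s\<close> restricts to
  \<open>[s, s]\<close> on the pair below; this forces \<open>chain_pr\<close> on its own pair,
  which does not contain the braid. A braid of length \<open>3\<close> beginning with the larger
  letter \<open>s\<close> restricts to the forbidden \<open>[s, s]\<close> on the pair
  above.\<close>

lemma proper_imp_good:
  assumes p: "proper n u"
  shows "B.good n u"
proof -
  have "(\<forall>x y s. v \<noteq> x @ [s, s] @ y) \<and> (\<forall>x y s t. 3 \<le> B_matrix n s t \<longrightarrow> v \<noteq> x @ alt s t (B_matrix n s t) @ y)"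
    if uv: "comm_B n u v" for v
  proof -
    have l: "set v \<subseteq> {1..n}" using B.comm_set[OF uv] p by (auto simp: proper_def)
    have pv: "\<not> sublist [i, i] (pr i v)" if "i < n" for i
      using p that pr_comm[OF uv] by (simp add: proper_def)
    have pn: "\<not> sublist [n, n] (pr (n - 1) v)"
      using p pr_comm[OF uv] by (simp add: proper_def)
    have pc: "pr (Suc j) v = chain_pr n (Suc j)" if "Suc j < n" "sublist [Suc j, Suc j] (pr j v)" for j
      using p that pr_comm[OF uv] by (simp add: proper_def)
    have 1: False if v: "sublist [s, s] v" for s
    proof -
      have s: "s \<in> {1..n}" using l set_mono_sublist[OF v] by auto
      show False
      proof (cases "s = n")
        case True
        then have "sublist [n, n] (pr (n - 1) v)"
          using sublist_filter[OF v, of "\<lambda>x. x = n - 1 \<or> x = Suc (n - 1)"] s by auto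
        then show ?thesis using pn by blast
      next
        case False
        then show ?thesis
          using sublist_filter[OF v, of "\<lambda>x. x = s \<or> x = Suc s"] pv[of s] s by auto
      qed
    qed
    have 2: False if m: "3 \<le> B_matrix n s t" and v: "sublist (alt s t (B_matrix n s t)) v" for s t
    proof -
      have "{s, t} \<subseteq> set (alt s t (B_matrix n s t))"
        using m by (auto simp: B_matrix_def numeral_eq_Suc split: if_splits)
      then have st: "s \<in> {1..n}" "t \<in> {1..n}" using l set_mono_sublist[OF v] by auto
      obtain r where r: "s = Suc r" using st by (cases s) auto
      obtain q where q: "t = Suc q" using st by (cases t) auto
      from st show False
      proof (cases rule: B_matrix_cases)
        case 3
        then have v': "sublist [s, t, s] v" using v by (simp add: B_matrix_def numeral_eq_Suc)
        have "sublist [s, s] (pr r v)"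
          using sublist_filter[OF v', of "\<lambda>x. x = r \<or> x = Suc r"] 3 r by simp
        then have "pr s v = chain_pr n s" using pc[of r] 3 r by simp
        moreover have "sublist [s, t, s] (pr s v)"
          using sublist_filter[OF v', of "\<lambda>x. x = s \<or> x = Suc s"] 3 by simp
        ultimately show False using 3 by (simp add: chain_pr_def sublist_Cons_right)
      next
        case 4
        then have v': "sublist [s, t, s] v" using v by (simp add: B_matrix_def numeral_eq_Suc)
        have "sublist [s, s] (pr s v)"
          using sublist_filter[OF v', of "\<lambda>x. x = s \<or> x = Suc s"] 4 by simp
        then show False using pv 4 by blast
      next
        case 5
        then have v': "sublist [s, t, s, t] v" using v by (simp add: B_matrix_def numeral_eq_Suc)
        have "sublist [s, s] (pr r v)"
          using sublist_filter[OF v', of "\<lambda>x. x = r \<or> x = Suc r"] 5 r by simp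
        then have "pr s v = chain_pr n s" using pc[of r] 5 r by simp
        moreover have "sublist [s, t, s, t] (pr s v)"
          using sublist_filter[OF v', of "\<lambda>x. x = s \<or> x = Suc s"] 5 by simp
        ultimately show False using 5 sublist_length_le[of "[s, t, s, t]" "pr s v"] by (simp add: chain_pr_def)
      next
        case 6
        then have v': "sublist [s, t, s, t] v" using v by (simp add: B_matrix_def numeral_eq_Suc)
        have "sublist [t, t] (pr q v)"
          using sublist_filter[OF v', of "\<lambda>x. x = q \<or> x = Suc q"] 6 q by simp
        then have "pr t v = chain_pr n t" using pc[of q] 6 q by simp
        moreover have "sublist [s, t, s, t] (pr t v)"
          using sublist_filter[OF v', of "\<lambda>x. x = t \<or> x = Suc t"] 6 by simp
        ultimately show False using 6 sublist_length_le[of "[s, t, s, t]" "pr t v"] by (simp add: chain_pr_def)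
      qed (use m in \<open>auto simp: B_matrix_def\<close>)
    qed
    show ?thesis using 1 2 by (metis sublist_appendI)
  qed
  then show ?thesis using p unfolding B.good_def proper_def by blast
qed

lemma good_iff_proper:
  assumes "0 < n"
  shows "B.good n u \<longleftrightarrow> proper n u"
proof
  assume g: "B.good n u"
  then show "proper n u"
    unfolding proper_def
    using B.good_in_lists[OF g] good_pr_no_square[OF g] good_pr_no_square_last[OF g, of "n - 1"]
      good_peak[OF g] assms by simp
qed (rule proper_imp_good)

section \<open>Generating functions of lattice paths\<close>

text \<open>A path is the list of its steps (\<open>True\<close> for an up-step) in reverse order, the last step first.
  By truncated subtraction a down-step at height \<open>0\<close> stays at \<open>0\<close>. The peaks are the positions
  of the up-steps that are last or followed by a down-step.\<close>

fun height :: "bool list \<Rightarrow> nat" where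
  "height [] = 0"
| "height (True # bs) = Suc (height bs)"
| "height (False # bs) = height bs - 1"

fun peaks :: "bool list \<Rightarrow> nat set" where
  "peaks [] = {}"
| "peaks (True # bs) = insert (Suc (length bs)) (peaks bs - {length bs})"
| "peaks (False # bs) = peaks bs"

lemma peaks_bound: "peaks bs \<subseteq> {1..length bs}"
  by (induction bs rule: peaks.induct) auto

lemma finite_peaks [simp]: "finite (peaks bs)"
  using peaks_bound finite_subset by blast

text \<open>Whether a final up-step remains a peak depends on the next step. Leaving out the end
  position gives a statistic that a further up-step does not change.\<close>

abbreviation inner_maj :: "bool list \<Rightarrow> nat" where
  "inner_maj bs \<equiv> \<Sum>(peaks bs - {length bs})"

lemma inner_maj_simps [simp]:
  "inner_maj (True # bs) = inner_maj bs"
  "inner_maj (False # bs) = \<Sum>(peaks bs)"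
proof -
  have *: "Suc (length bs) \<notin> peaks bs" using peaks_bound[of bs] by auto
  then have "peaks (True # bs) - {length (True # bs)} = peaks bs - {length bs}" by auto
  then show "inner_maj (True # bs) = inner_maj bs" by simp
  show "inner_maj (False # bs) = \<Sum>(peaks bs)" using * by simp
qed

lemma sum_peaks:
  "\<Sum>(peaks (True # bs)) = Suc (length bs) + inner_maj bs"
  "\<Sum>(peaks (False # bs)) = \<Sum>(peaks bs)"
proof -
  have "Suc (length bs) \<notin> peaks bs" using peaks_bound[of bs] by auto
  then show "\<Sum>(peaks (True # bs)) = Suc (length bs) + inner_maj bs"
    by (simp add: sum.insert)
qed simp

lemma finite_lists_length [simp]: "finite {bs :: bool list. length bs = n}"
  using finite_lists_length_eq[of "UNIV :: bool set" n] by simp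

lemma sum_lists_Suc:
  fixes f :: "bool list \<Rightarrow> 'a :: comm_monoid_add"
  shows "(\<Sum>bs | length bs = Suc n \<and> P bs. f bs) =
    (\<Sum>bs | length bs = n \<and> P (True # bs). f (True # bs)) + (\<Sum>bs | length bs = n \<and> P (False # bs). f (False # bs))"
proof -
  have e: "{bs. length bs = Suc n \<and> P bs} =
    Cons True ` {bs. length bs = n \<and> P (True # bs)} \<union> Cons False ` {bs. length bs = n \<and> P (False # bs)}"
  proof (intro Set.set_eqI)
    show "bs \<in> {bs. length bs = Suc n \<and> P bs} \<longleftrightarrow> bs \<in>
      Cons True ` {bs. length bs = n \<and> P (True # bs)} \<union> Cons False ` {bs. length bs = n \<and> P (False # bs)}" for bs
      by (cases bs rule: height.cases) auto
  qed
  have fin: "finite {bs :: bool list. length bs = n \<and> Q bs}" for Q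
    by (rule finite_subset[OF _ finite_lists_length[of n]]) auto
  show ?thesis
    unfolding e by (subst sum.union_disjoint) (auto simp: fin sum.reindex)
qed

text \<open>The denominator of \<^const>\<open>qbinomial\<close> does not vanish when \<open>q\<close> is not a root of unity.\<close>

locale q_series =
  fixes q :: "'a :: field"
  assumes not_root_of_unity: "0 < j \<Longrightarrow> q ^ j \<noteq> 1"
begin

section \<open>Identities for \<open>q\<close>-binomial coefficients\<close>

abbreviation qb where "qb \<equiv> qbinomial q"

lemma qfact_nonzero: "(\<Prod>j=1..n. 1 - q ^ j) \<noteq> 0"
  using not_root_of_unity by auto

lemma qb_0 [simp]: "qb n 0 = 1"
  using qfact_nonzero[of n] by (simp add: qbinomial_def)

lemma qb_self [simp]: "qb n n = 1"
  using qfact_nonzero[of n] by (simp add: qbinomial_def)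

lemma qb_symmetric: "k \<le> n \<Longrightarrow> qb n (n - k) = qb n k"
  by (simp add: qbinomial_def mult.commute)

lemma qb_absorb:
  assumes "k \<le> n"
  shows "(1 - q ^ (Suc n - k)) * qb (Suc n) k = (1 - q ^ Suc n) * qb n k"
proof -
  obtain d where d: "n = k + d" using assms by (metis le_add_diff_inverse)
  have "1 - q ^ Suc d \<noteq> 0" using not_root_of_unity[of "Suc d"] by simp
  then show ?thesis
    using qfact_nonzero[of k] qfact_nonzero[of d]
    by (simp add: qbinomial_def d Suc_diff_le field_simps del: power_Suc)
qed

lemma qb_pascal:
  assumes "k < n"
  shows "qb (Suc n) (Suc k) = qb n (Suc k) + q ^ (n - k) * qb n k"
proof -
  obtain d where d: "n = Suc (k + d)" using assms by (metis less_iff_Suc_add)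
  define A B C where "A = (\<Prod>j=1..n. 1 - q ^ j)" "B = (\<Prod>j=1..k. 1 - q ^ j)" "C = (\<Prod>j=1..d. 1 - q ^ j)"
  define x y where "x = q ^ Suc k" "y = q ^ Suc d"
  have nz: "B \<noteq> 0" "C \<noteq> 0" "1 - x \<noteq> 0" "1 - y \<noteq> 0"
    using qfact_nonzero not_root_of_unity[of "Suc k"] not_root_of_unity[of "Suc d"]
    by (simp_all add: A_B_C_def x_y_def)
  have xy: "q ^ Suc n = x * y" by (simp add: x_y_def d power_add)
  have f: "(\<Prod>j=1..Suc n. 1 - q ^ j) = A * (1 - x * y)" "(\<Prod>j=1..Suc k. 1 - q ^ j) = B * (1 - x)"
    "(\<Prod>j=1..Suc d. 1 - q ^ j) = C * (1 - y)"
    unfolding xy[symmetric] by (simp_all add: A_B_C_def x_y_def del: power_Suc)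
  have 1: "qb (Suc n) (Suc k) = A * (1 - x * y) / ((B * (1 - x)) * (C * (1 - y)))"
  proof -
    have "Suc n - Suc k = Suc d" by (simp add: d)
    then show ?thesis by (simp only: qbinomial_def f)
  qed
  have 2: "qb n (Suc k) = A / ((B * (1 - x)) * C)"
    unfolding qbinomial_def f by (simp add: d A_B_C_def)
  have 3: "qb n k = A / (B * (C * (1 - y)))"
    unfolding qbinomial_def f(3)[symmetric] by (simp add: d A_B_C_def del: prod.cl_ivl_Suc)
  have 4: "q ^ (n - k) = y" by (simp add: x_y_def d)
  show ?thesis unfolding 1 2 3 4 using nz by (simp add: divide_simps) (simp add: algebra_simps)
qed

text \<open>These are the Galois numbers, which for a prime power \<open>q\<close> count the
  subspaces of an \<open>n\<close>-dimensional space over the field with \<open>q\<close>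
  elements.\<close>

definition galois :: "nat \<Rightarrow> 'a" where
  "galois n = (\<Sum>i=0..n. qb n i)"

text \<open>The Goldman-Rota recurrence. Absorption rewrites the weighted term of the
  \<open>q\<close>-Pascal rule, and the result is summed over the lower index.\<close>

lemma galois_rec: "galois (Suc (Suc n)) = 2 * galois (Suc n) - (1 - q ^ Suc n) * galois n"
proof -
  let ?n = "Suc n"
  have p: "qb (Suc ?n) (Suc k) = qb ?n (Suc k) + qb ?n k - (1 - q ^ ?n) * qb n k" if "k \<le> n" for k
    using qb_pascal[of k ?n] qb_absorb[OF that] that by (simp add: algebra_simps)
  have "galois (Suc ?n) = qb (Suc ?n) 0 + (\<Sum>k=0..n. qb (Suc ?n) (Suc k)) + qb (Suc ?n) (Suc ?n)"
    unfolding galois_def by (subst sum.atLeast0_atMost_Suc, subst sum.atLeast0_atMost_Suc_shift) (simp add: o_def)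
  also have "(\<Sum>k=0..n. qb (Suc ?n) (Suc k)) =
      (\<Sum>k=0..n. qb ?n (Suc k)) + (\<Sum>k=0..n. qb ?n k) - (1 - q ^ ?n) * galois n"
    by (simp add: p galois_def sum.distrib sum_subtractf sum_distrib_left)
  also have "(\<Sum>k=0..n. qb ?n (Suc k)) = galois ?n - 1"
    unfolding galois_def by (subst sum.atLeast0_atMost_Suc_shift) (simp add: o_def)
  also have "(\<Sum>k=0..n. qb ?n k) = galois ?n - 1"
    unfolding galois_def by simp
  finally show ?thesis by (simp add: algebra_simps)
qed

section \<open>Path sums by last step\<close>

definition all_paths :: "nat \<Rightarrow> 'a" where
  "all_paths n = (\<Sum>bs | length bs = n. q ^ inner_maj bs)"

definition paths_to :: "nat \<Rightarrow> nat \<Rightarrow> 'a" where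
  "paths_to n h = (\<Sum>bs | length bs = n \<and> height bs = h. q ^ inner_maj bs)"

lemma sum_peaks_paths_Suc:
  "(\<Sum>bs | length bs = Suc n \<and> P bs. q ^ \<Sum>(peaks bs)) =
    q ^ Suc n * (\<Sum>bs | length bs = n \<and> P (True # bs). q ^ inner_maj bs) +
    (\<Sum>bs | length bs = n \<and> P (False # bs). q ^ \<Sum>(peaks bs))"
  unfolding sum_lists_Suc sum_peaks sum_distrib_left
  by (intro arg_cong2[where f = "(+)"] sum.cong) (auto simp: power_add)

lemma inner_maj_paths_Suc:
  "(\<Sum>bs | length bs = Suc n \<and> P bs. q ^ inner_maj bs) =
    (\<Sum>bs | length bs = n \<and> P (True # bs). q ^ inner_maj bs) +
    (\<Sum>bs | length bs = n \<and> P (False # bs). q ^ \<Sum>(peaks bs))"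
  unfolding sum_lists_Suc inner_maj_simps ..

text \<open>Splitting off the last step relates \<open>all_paths\<close> to the sum
  \<open>?F\<close> with all peaks counted; eliminating \<open>?F\<close> leaves the recurrence of
  the Galois numbers.\<close>

lemma all_paths_eq: "all_paths n = galois n"
proof (induction n rule: induct_nat_012)
  case 0
  have "{bs :: bool list. length bs = 0} = {[]}" by auto
  then show ?case by (simp add: all_paths_def galois_def)
next
  case 1
  have "{bs :: bool list. length bs = 0} = {[]}" by auto
  then show ?case
    using inner_maj_paths_Suc[of 0 "\<lambda>_. True"] by (simp add: all_paths_def galois_def)
next
  case (ge2 n)
  let ?F = "\<lambda>n. \<Sum>bs | length bs = n. q ^ \<Sum>(peaks bs)"
  have 1: "all_paths (Suc m) = all_paths m + ?F m" for m
    using inner_maj_paths_Suc[of m "\<lambda>_. True"] by (simp add: all_paths_def)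
  have "?F (Suc n) = q ^ Suc n * all_paths n + ?F n"
    using sum_peaks_paths_Suc[of n "\<lambda>_. True"] by (simp add: all_paths_def)
  then have "all_paths (Suc (Suc n)) = 2 * all_paths (Suc n) - (1 - q ^ Suc n) * all_paths n"
    using 1[of n] 1[of "Suc n"] by (simp add: algebra_simps)
  then show ?case using ge2 galois_rec by simp
qed

text \<open>The index \<open>h\<close> is the position of the last up-step, always a peak, and the
  summand \<open>1\<close> belongs to the path without up-steps.\<close>

lemma sum_all_peaks:
  "(\<Sum>bs | length bs = n. q ^ \<Sum>(peaks bs)) = 1 + (\<Sum>h=1..n. q ^ h * galois (h - 1))"
proof (induction n)
  case 0
  have "{bs :: bool list. length bs = 0} = {[]}" by auto
  then show ?case by simp
next
  case (Suc n)
  then show ?case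
    using sum_peaks_paths_Suc[of n "\<lambda>_. True"] all_paths_eq[of n] by (simp add: all_paths_def)
qed

definition peak_paths_to :: "nat \<Rightarrow> nat \<Rightarrow> 'a" where
  "peak_paths_to n h = (\<Sum>bs | length bs = n \<and> height bs = h. q ^ \<Sum>(peaks bs))"

text \<open>The two statistics differ only on paths ending with an up-step, where the end position
  contributes the factor \<open>q ^ Suc n\<close> to one of them.\<close>

lemma peak_paths_to_Suc:
  "peak_paths_to (Suc n) h =
    paths_to (Suc n) h - (if h = 0 then 0 else (1 - q ^ Suc n) * paths_to n (h - 1))"
proof -
  have "{bs. length bs = n \<and> Suc (height bs) = h} =
      (if h = 0 then {} else {bs. length bs = n \<and> height bs = h - 1})"
    by auto
  then show ?thesis
    unfolding peak_paths_to_def paths_to_def sum_peaks_paths_Suc inner_maj_paths_Suc height.simps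
    by (simp add: algebra_simps)
qed

lemma paths_to_Suc:
  "paths_to (Suc n) h = (if h = 0 then peak_paths_to n 0 else paths_to n (h - 1)) + peak_paths_to n (Suc h)"
proof -
  have fin: "finite {bs :: bool list. length bs = n \<and> Q bs}" for Q
    by (rule finite_subset[OF _ finite_lists_length[of n]]) auto
  have up: "{bs. length bs = n \<and> Suc (height bs) = h} =
      (if h = 0 then {} else {bs. length bs = n \<and> height bs = h - 1})"
    by auto
  have down: "{bs. length bs = n \<and> height bs - 1 = h} =
      {bs. length bs = n \<and> height bs = Suc h} \<union> (if h = 0 then {bs. length bs = n \<and> height bs = 0} else {})"
    by auto
  have "(\<Sum>bs | length bs = n \<and> height bs - 1 = h. q ^ \<Sum>(peaks bs)) =
      peak_paths_to n (Suc h) + (if h = 0 then peak_paths_to n 0 else 0)"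
    unfolding down peak_paths_to_def by (subst sum.union_disjoint) (auto simp: fin)
  then show ?thesis
    unfolding paths_to_def inner_maj_paths_Suc height.simps up by simp
qed

lemma paths_to_Nil: "paths_to 0 h = (if h = 0 then 1 else 0)"
proof -
  have "{bs. length bs = 0 \<and> height bs = h} = (if h = 0 then {[]} else {})" by auto
  then show ?thesis by (simp add: paths_to_def)
qed

lemma peak_paths_to_Nil: "peak_paths_to 0 h = (if h = 0 then 1 else 0)"
proof -
  have "{bs. length bs = 0 \<and> height bs = h} = (if h = 0 then {[]} else {})" by auto
  then show ?thesis by (simp add: peak_paths_to_def)
qed

text \<open>Combining the two one-step recursions yields a recursion in \<open>paths_to\<close>
  alone, valid at \<open>h = 0\<close> too because of the truncated \<open>h - 1\<close>. The closed
  form satisfies it by the \<open>q\<close>-Pascal rule and absorption.\<close>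

lemma paths_to_eq: "paths_to n h = (if h \<le> n then qb n ((n - h) div 2) else 0)"
proof (induction n arbitrary: h rule: induct_nat_012)
  case 0
  then show ?case by (simp add: paths_to_Nil)
next
  case 1
  then show ?case
    by (auto simp: paths_to_Suc paths_to_Nil peak_paths_to_Nil le_Suc_eq)
next
  case (ge2 n)
  have rec: "paths_to (Suc (Suc n)) h = paths_to (Suc n) (h - 1) + paths_to (Suc n) (Suc h)
    - (1 - q ^ Suc n) * paths_to n h"
    by (simp add: paths_to_Suc[of "Suc n"] peak_paths_to_Suc)
  show ?case
  proof (cases "h \<le> n")
    case True
    define k where "k = (n - h) div 2"
    have k: "k \<le> n" unfolding k_def by linarith
    have 1: "paths_to (Suc n) (h - 1) = qb (Suc n) (Suc k)"
    \<comment> \<open>Here truncation keeps the height at \<open>0\<close> and the lower index is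
      \<open>k\<close> instead of \<open>Suc k\<close>. As \<open>Suc n = 2 * k + 1\<close>, the two
      coefficients agree by symmetry.\<close>
    proof (cases "h = 0 \<and> even n")
      case True
      then have n: "n = k + k" by (auto simp: k_def)
      have "paths_to (Suc n) (h - 1) = qb (Suc n) k" using True ge2.IH(2)[of 0] by (simp add: k_def)
      also have "\<dots> = qb (Suc n) (Suc k)" using qb_symmetric[of k "Suc n"] unfolding n by (simp add: Suc_diff_le)
      finally show ?thesis .
    next
      case False
      then have "(Suc n - (h - 1)) div 2 = Suc k" using \<open>h \<le> n\<close> unfolding k_def by (cases h) (auto elim: oddE simp: Suc_diff_le)
      then show ?thesis using ge2.IH(2)[of "h - 1"] \<open>h \<le> n\<close> by auto
    qed
    have 2: "paths_to (Suc n) (Suc h) = qb (Suc n) k" "paths_to n h = qb n k"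
      using ge2.IH True by (simp_all add: k_def)
    have 3: "(Suc (Suc n) - h) div 2 = Suc k" using True by (simp add: k_def Suc_diff_le)
    show ?thesis
      unfolding rec 1 2 3 using qb_pascal[of k "Suc n"] qb_absorb[OF k] k True
      by (simp add: algebra_simps)
  next
    case False
    then show ?thesis unfolding rec using ge2.IH by (auto simp: le_Suc_eq)
  qed
qed

text \<open>A path ending at height \<open>0\<close> does not end with an up-step, so both
  statistics agree on it. Hence \<open>peak_paths_to j 1\<close> is the increment of
  \<open>paths_to j 0\<close> in \<open>j\<close>, and the sum telescopes.\<close>

lemma sum_peak_paths_to_1:
  assumes "0 < n"
  shows "1 + (\<Sum>j=1..<n. peak_paths_to j 1) = qb n (n div 2)"
proof -
  have F0: "peak_paths_to j 0 = paths_to j 0" for j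
    by (cases j) (simp_all add: peak_paths_to_Suc paths_to_Nil peak_paths_to_Nil)
  have "1 + (\<Sum>j=1..<n. peak_paths_to j 1) = paths_to n 0"
    using assms
  proof (induction n rule: nat_induct_non_zero)
    case 1
    then show ?case by (simp add: paths_to_eq)
  next
    case (Suc n)
    then show ?case using paths_to_Suc[of n 0] F0[of n] by (simp add: algebra_simps)
  qed
  then show ?thesis by (simp add: paths_to_eq)
qed

end

section \<open>The indeterminate is not a root of unity\<close>

lemma qvar_power: "qvar ^ j = Fract (monom 1 j) 1"
proof (induction j)
  case 0
  then show ?case by (simp add: One_fract_def monom_0 one_pCons)
next
  case (Suc j)
  then show ?case by (simp add: qvar_def monom_Suc)
qed

interpretation qvar: q_series qvar
proof
  fix j :: nat assume "0 < j"
  then have "degree (monom (1 :: rat) j) \<noteq> degree (1 :: rat poly)" by (simp add: degree_monom_eq)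
  then have "monom (1 :: rat) j \<noteq> 1" by metis
  then show "qvar ^ j \<noteq> 1" by (simp add: qvar_power One_fract_def eq_fract)
qed

section \<open>Self-dual fully commutative words\<close>

text \<open>The word of a path contains the letter \<open>i\<close> as often as the height of the path after \<open>i\<close> steps.\<close>

definition insert_next :: "nat \<Rightarrow> nat list \<Rightarrow> nat list" where
  "insert_next k u = concat (map (\<lambda>x. if x = k then [Suc k, k] else [x]) u)"

text \<open>With \<open>k\<close> the length so far, a letter \<open>k + 1\<close> is put before
  every \<open>k\<close>. An up-step adds one more at the end, a down-step removes the first one;
  either way the restriction to these two letters alternates and has equal ends. At height
  \<open>0\<close> a down-step finds nothing to remove.\<close>

fun alternating_word :: "bool list \<Rightarrow> nat list" where
  "alternating_word [] = []"
| "alternating_word (True # bs) = insert_next (length bs) (alternating_word bs) @ [Suc (length bs)]"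
| "alternating_word (False # bs) = remove1 (Suc (length bs)) (insert_next (length bs) (alternating_word bs))"

lemma filter_insert_next: "\<not> P (Suc k) \<Longrightarrow> filter P (insert_next k u) = filter P u"
  by (induction u) (auto simp: insert_next_def)

lemma set_insert_next: "set (insert_next k u) \<subseteq> insert (Suc k) (set u)"
  by (auto simp: insert_next_def split: if_splits)

lemma set_alternating_word: "set (alternating_word bs) \<subseteq> {1..length bs}"
proof (induction bs rule: alternating_word.induct)
  case (2 bs)
  then show ?case using set_insert_next[of "length bs" "alternating_word bs"] by fastforce
next
  case (3 bs)
  then show ?case
    using set_insert_next[of "length bs" "alternating_word bs"]
      set_remove1_subset[of "Suc (length bs)" "insert_next (length bs) (alternating_word bs)"]
    by fastforce
qed simp

lemma pr_alternating_word_Cons: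
  assumes "i < length bs"
  shows "pr i (alternating_word (b # bs)) = pr i (alternating_word bs)"
proof -
  have "Suc (length bs) \<notin> set (alternating_word bs)" using set_alternating_word[of bs] by auto
  then show ?thesis
    using assms by (cases b) (simp_all add: filter_insert_next filter_remove1 remove1_idem)
qed

lemma pr_insert_next:
  "Suc k \<notin> set u \<Longrightarrow> pr k (insert_next k u) = alt (Suc k) k (2 * count_list u k)"
  by (induction u) (auto simp: insert_next_def)

lemma alt_Suc_even: "alt a b (Suc (2 * c)) = alt a b (2 * c) @ [a]"
  by (subst alt_snoc_rev) simp

lemma last_alt_odd [simp]: "last (alt a b (Suc (2 * c))) = a"
  by (subst alt_Suc_even) simp

lemma count_alt_odd:
  assumes "a \<noteq> b"
  shows "count_list (alt a b (Suc (2 * c))) a = Suc c" "count_list (alt a b (Suc (2 * c))) b = c"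
  using assms by (induction c) auto

text \<open>The count is a hypothesis because it is proved by an induction that uses this lemma. At
  height \<open>0\<close> the truncated \<open>2 * height bs - 1\<close> gives the empty
  word.\<close>

lemma pr_alternating_word_length_aux:
  assumes "count_list (alternating_word bs) (length bs) = height bs" "k = length bs"
  shows "pr k (alternating_word (b # bs)) =
    (if b then alt (Suc k) k (Suc (2 * height bs)) else alt k (Suc k) (2 * height bs - 1))"
proof -
  have k: "Suc k \<notin> set (alternating_word bs)" using set_alternating_word[of bs] assms(2) by auto
  then have p: "pr k (insert_next k (alternating_word bs)) = alt (Suc k) k (2 * height bs)"
    using pr_insert_next assms by simp
  show ?thesis
  proof (cases b)
    case True
    then show ?thesis using p assms(2) by (simp add: alt_Suc_even del: alt.simps)
  next
    case False
    then show ?thesis using p assms(2) by (cases "height bs") (simp_all add: filter_remove1)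
  qed
qed

lemma count_alternating_word: "count_list (alternating_word bs) (length bs) = height bs"
proof (induction bs)
  case (Cons b bs)
  have "count_list (alternating_word (b # bs)) (Suc (length bs)) =
      count_list (pr (length bs) (alternating_word (b # bs))) (Suc (length bs))"
    by (rule count_list_pr(2)[symmetric])
  also have "\<dots> = height (b # bs)"
  proof (cases b)
    case True
    then show ?thesis
      using pr_alternating_word_length_aux[OF Cons HOL.refl, of True] count_alt_odd[of "Suc (length bs)" "length bs"]
      by (simp del: alt.simps alternating_word.simps)
  next
    case False
    then show ?thesis
      using pr_alternating_word_length_aux[OF Cons HOL.refl, of False] count_alt_odd[of "length bs" "Suc (length bs)"]
      by (cases "height bs") (simp_all del: alt.simps(2) alternating_word.simps)
  qed
  finally show ?case by (simp del: alternating_word.simps)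
qed simp

lemmas pr_alternating_word_length = pr_alternating_word_length_aux[OF count_alternating_word HOL.refl]

lemma alt_no_square: "a \<noteq> b \<Longrightarrow> \<not> sublist [x, x] (alt a b k)"
proof (induction k arbitrary: a b)
  case (Suc k)
  then show ?case by (cases k) (auto simp: sublist_Cons_right)
qed simp

lemma pr_alternating_word:
  assumes "i < length bs"
  shows "(\<exists>c. pr i (alternating_word bs) = alt i (Suc i) (Suc (2 * c))) \<or>
    (\<exists>c. pr i (alternating_word bs) = alt (Suc i) i (Suc (2 * c))) \<or> pr i (alternating_word bs) = []"
  using assms
proof (induction bs)
  case (Cons b bs)
  show ?case
  proof (cases "i < length bs")
    case True
    show ?thesis unfolding pr_alternating_word_Cons[OF True] by (rule Cons.IH[OF True])
  next
    case False
    then have i: "i = length bs" using Cons.prems by simp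
    show ?thesis
    proof (cases b)
      case True
      then show ?thesis unfolding i pr_alternating_word_length by auto
    next
      case False
      have "2 * height bs - 1 = 0 \<or> (\<exists>c. 2 * height bs - 1 = Suc (2 * c))"
        by (cases "height bs") auto
      then show ?thesis using False unfolding i pr_alternating_word_length by fastforce
    qed
  qed
qed simp

section \<open>Palindromic restrictions\<close>

definition self_dual :: "nat \<Rightarrow> nat list \<Rightarrow> bool" where
  "self_dual n u \<longleftrightarrow> proper n u \<and> (\<forall>i<n. rev (pr i u) = pr i u)"

lemma good_involution_iff:
  assumes "0 < n"
  shows "B.good n u \<and> comm_B n u (rev u) \<longleftrightarrow> self_dual n u"
proof -
  have "comm_B n u (rev u) \<longleftrightarrow> (\<forall>i<n. rev (pr i u) = pr i u)" if "u \<in> lists {1..n}"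
    using comm_B_iff[of u n "rev u"] that by (auto simp: rev_filter)
  then show ?thesis
    using good_iff_proper[OF assms] unfolding self_dual_def proper_def by blast
qed

lemma alternating_word_no_square:
  "i < length bs \<Longrightarrow> \<not> sublist [x, x] (pr i (alternating_word bs))"
  using pr_alternating_word[of i bs] alt_no_square[of i "Suc i" x] alt_no_square[of "Suc i" i x]
  by (auto simp del: alt.simps)

lemma alternating_word_palindrome:
  "i < length bs \<Longrightarrow> rev (pr i (alternating_word bs)) = pr i (alternating_word bs)"
  using pr_alternating_word[of i bs] rev_alt_odd by fastforce

lemma self_dual_alternating_word:
  assumes "length bs = n" "0 < n"
  shows "self_dual n (alternating_word bs)"
proof -
  have "alternating_word bs \<in> lists {1..n}" using set_alternating_word[of bs] assms by auto
  moreover have "n - 1 < length bs" using assms by simp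
  ultimately show ?thesis
    unfolding self_dual_def proper_def
    using alternating_word_no_square[of _ bs] alternating_word_palindrome[of _ bs]
      alternating_word_no_square[of "n - 1" bs n] assms
    by simp
qed

section \<open>Descents read off from the restrictions\<close>

text \<open>Being last in both restrictions means that no neighbour follows the last
  \<open>s\<close>, so that this \<open>s\<close> can be moved to the end. Membership in
  \<open>set u\<close> keeps \<open>last\<close> away from empty lists.\<close>

definition descents :: "nat list \<Rightarrow> nat set" where
  "descents u = {s \<in> set u. last (pr (s - 1) u) = s \<and> last (pr s u) = s}"

lemma descents_eq:
  assumes u: "u \<in> lists {1..n}"
  shows "{s. \<exists>x. comm_B n u (x @ [s])} = descents u"
proof (intro Set.set_eqI iffI)
  fix s assume "s \<in> {s. \<exists>x. comm_B n u (x @ [s])}"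
  then obtain x where x: "comm_B n u (x @ [s])" by blast
  have s: "s \<in> set u" using B.comm_set[OF x] by simp
  moreover have "0 < s" using s u by auto
  ultimately show "s \<in> descents u" by (simp add: descents_def pr_comm[OF x])
next
  fix s assume "s \<in> descents u"
  then have s: "s \<in> set u" "last (pr (s - 1) u) = s" "last (pr s u) = s" by (auto simp: descents_def)
  have pos: "0 < s" using s u by auto
  obtain a b where ab: "u = a @ s # b" "s \<notin> set b" using s(1) by (meson split_list_last)
  have "\<not> nb s x" if x: "x \<in> set b" for x
  proof
    assume "nb s x"
    moreover define i where "i = (if Suc x = s then x else s)"
    ultimately have i: "i = s - 1 \<or> i = s" "x = i \<or> x = Suc i" by auto
    then have "pr i b \<noteq> []" using x by (auto simp: filter_empty_conv)
    moreover have "pr i u = pr i a @ s # pr i b" using ab i pos by auto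
    ultimately have "last (pr i u) \<in> set b" using last_in_set by fastforce
    then show False using s i ab by auto
  qed
  then have "comm_B n (a @ [s] @ b @ []) (a @ b @ [s] @ [])" using ab by (intro comm_front) auto
  then show "s \<in> {s. \<exists>x. comm_B n u (x @ [s])}" using ab by (auto intro!: exI[of _ "a @ b"])
qed

lemma in_set_pr: "s \<in> set (pr s u) \<longleftrightarrow> s \<in> set u" "Suc s \<in> set (pr s u) \<longleftrightarrow> Suc s \<in> set u"
  by auto

lemma last_pr_top:
  assumes "set u \<subseteq> {1..s}" "s \<in> set u"
  shows "last (pr s u) = s"
proof -
  have "set (pr s u) \<subseteq> {s}" "pr s u \<noteq> []" using assms by (auto simp: filter_empty_conv)
  then show ?thesis using last_in_set by fastforce
qed

text \<open>A further step leaves the restrictions of lower index unchanged and creates the one to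
  \<open>?k\<close> and \<open>Suc ?k\<close>. It ends in \<open>Suc ?k\<close> after an up-step,
  which makes this letter a descent in place of \<open>?k\<close>. After a down-step it is empty or
  ends in \<open>?k\<close>, so no descent changes.\<close>

lemma descents_alternating_word: "descents (alternating_word bs) = peaks bs"
proof (induction bs)
  case (Cons b bs)
  let ?k = "length bs" and ?u = "alternating_word bs" and ?v = "alternating_word (b # bs)"
  have sv: "set ?v \<subseteq> {1..Suc ?k}" using set_alternating_word[of "b # bs"] by simp
  have su: "set ?u \<subseteq> {1..?k}" by (rule set_alternating_word)
  note top = pr_alternating_word_length[of bs b]
  show ?case
  proof (intro Set.set_eqI)
    fix s
    consider "s = 0" | "0 < s" "s < ?k" | "0 < s" "s = ?k" | "s = Suc ?k" | "Suc ?k < s" by linarith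
    then show "s \<in> descents ?v \<longleftrightarrow> s \<in> peaks (b # bs)"
    proof cases
      case 2
      then have "pr (s - 1) ?v = pr (s - 1) ?u" "pr s ?v = pr s ?u"
        using pr_alternating_word_Cons[of "s - 1" bs b] pr_alternating_word_Cons[of s bs b] by simp_all
      then have "s \<in> descents ?v \<longleftrightarrow> s \<in> descents ?u"
        unfolding descents_def using in_set_pr(1)[of s ?v] in_set_pr(1)[of s ?u] by auto
      then show ?thesis using Cons 2 by (cases b) auto
    next
      case 3
      have p: "pr (s - 1) ?v = pr (s - 1) ?u" using 3 by (intro pr_alternating_word_Cons) simp
      then have m: "s \<in> set ?v \<longleftrightarrow> s \<in> set ?u"
        using in_set_pr(2)[of "s - 1" ?v] in_set_pr(2)[of "s - 1" ?u] 3 by simp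
      show ?thesis
      proof (cases b)
        case True
        then have "last (pr s ?v) \<noteq> s" using top 3 by (simp del: alternating_word.simps alt.simps)
        then show ?thesis using True 3 by (simp add: descents_def del: alternating_word.simps)
      next
        case False
        have "last (pr s ?v) = s" if "s \<in> set ?u"
        proof -
          have "height bs \<noteq> 0" using count_alternating_word[of bs] that 3 by (metis count_list_0_iff)
          then obtain c where "2 * height bs - 1 = Suc (2 * c)" by (cases "height bs") auto
          then show ?thesis using top False 3 by (simp del: alternating_word.simps alt.simps)
        qed
        then have "s \<in> descents ?v \<longleftrightarrow> s \<in> descents ?u"
          unfolding descents_def using p m last_pr_top[of ?u s] su 3 by auto
        then show ?thesis using Cons False by simp
      qed
    next
      case 4
      show ?thesis
      proof (cases b)
        case True
        have "Suc ?k \<in> set ?v" using True by simp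
        moreover have "last (pr ?k ?v) = Suc ?k" using top True by (simp del: alternating_word.simps alt.simps)
        ultimately show ?thesis
          using last_pr_top[OF sv] 4 True by (simp add: descents_def del: alternating_word.simps)
      next
        case False
        have "s \<notin> descents ?v"
        proof (cases "height bs")
          case 0
          then have "pr ?k ?v = []" using top False by (simp del: alternating_word.simps)
          then have "Suc ?k \<notin> set ?v" using in_set_pr(2)[of ?k ?v] by simp
          then show ?thesis using 4 by (simp add: descents_def del: alternating_word.simps)
        next
          case (Suc c)
          then have "pr ?k ?v = alt ?k (Suc ?k) (Suc (2 * c))" using top False by (simp del: alternating_word.simps)
          then show ?thesis using 4 by (simp add: descents_def del: alternating_word.simps alt.simps)
        qed
        then show ?thesis using False 4 peaks_bound[of bs] by auto
      qed
    next
      case 5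
      then show ?thesis using sv peaks_bound[of "b # bs"]
        by (auto simp: descents_def simp del: alternating_word.simps peaks.simps)
    qed (use sv peaks_bound[of "b # bs"] in \<open>auto simp: descents_def simp del: alternating_word.simps peaks.simps\<close>)
  qed
qed (simp add: descents_def)

section \<open>Words containing a chain\<close>

definition chain :: "nat \<Rightarrow> nat \<Rightarrow> nat list" where
  "chain n j = [j..<n] @ [n] @ rev [j..<n]"

text \<open>This undoes the contraction of a chain. It is applied to paths ending at height
  \<open>1\<close>, whose word contains the letter to be expanded exactly once.\<close>

definition chain_word :: "nat \<Rightarrow> bool list \<Rightarrow> nat list" where
  "chain_word n bs = concat (map (\<lambda>x. if x = length bs then chain n (length bs) else [x]) (alternating_word bs))"

lemma pr_chain:
  assumes "j \<le> i" "i < n"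
  shows "pr i (chain n j) = chain_pr n i"
proof -
  have "[j..<n] = [j..<i] @ i # [Suc i..<n]"
    using assms by (metis le_add_diff_inverse less_imp_le_nat upt_add_eq_append upt_conv_Cons)
  moreover have "pr i [j..<i] = []" by (auto simp: filter_empty_conv)
  moreover have "pr i [Suc i..<n] = (if Suc i < n then [Suc i] else [])"
  proof (cases "Suc i < n")
    case True
    then have "[Suc i..<n] = Suc i # [Suc (Suc i)..<n]" by (simp add: upt_conv_Cons)
    moreover have "pr i [Suc (Suc i)..<n] = []" by (auto simp: filter_empty_conv)
    ultimately show ?thesis using True by simp
  qed simp
  ultimately have "pr i [j..<n] = (if Suc i < n then [i, Suc i] else [i])" by simp
  then show ?thesis using assms by (auto simp: chain_def chain_pr_def simp flip: rev_filter)
qed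

lemma pr_chain_below: "Suc i < j \<Longrightarrow> j < n \<Longrightarrow> pr i (chain n j) = []"
  by (auto simp: chain_def filter_empty_conv)

lemma pr_chain_pred:
  assumes "Suc k < n"
  shows "pr k (chain n (Suc k)) = [Suc k, Suc k]"
proof -
  have "[Suc k..<n] = Suc k # [Suc (Suc k)..<n]" using assms by (simp add: upt_conv_Cons)
  moreover have "pr k [Suc (Suc k)..<n] = []" by (auto simp: filter_empty_conv)
  ultimately have "pr k [Suc k..<n] = [Suc k]" by simp
  then show ?thesis using assms by (simp add: chain_def flip: rev_filter)
qed

lemma filter_concat_replace:
  "filter P (concat (map (\<lambda>x. if x = j then c else [x]) u)) =
    concat (map (\<lambda>x. if x = j then filter P c else filter P [x]) u)"
  by (induction u) auto

lemma pr_chain_word_below: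
  assumes "length bs < n" "Suc i < length bs"
  shows "pr i (chain_word n bs) = pr i (alternating_word bs)"
proof -
  have "concat (map (\<lambda>x. if x = length bs then [] else filter (\<lambda>x. x = i \<or> x = Suc i) [x]) u) = pr i u" for u
    using assms by (induction u) auto
  then show ?thesis
    using pr_chain_below[of i "length bs" n] assms by (simp add: chain_word_def filter_concat_replace cong: if_cong)
qed

lemma pr_chain_word_pred:
  assumes "length bs = k" "Suc k < n" "height (b # bs) = 1"
  shows "pr k (chain_word n (b # bs)) = (if b then [Suc k, Suc k] else [k, Suc k, Suc k, k])"
proof -
  have "concat (map (\<lambda>x. if x = Suc k then [Suc k, Suc k] else filter (\<lambda>x. x = k \<or> x = Suc k) [x]) u) =
    concat (map (\<lambda>x. if x = Suc k then [Suc k, Suc k] else [x]) (pr k u))" for u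
    by (induction u) auto
  then have "pr k (chain_word n (b # bs)) =
      concat (map (\<lambda>x. if x = Suc k then [Suc k, Suc k] else [x]) (pr k (alternating_word (b # bs))))"
    using pr_chain_pred[of k n] assms by (simp add: chain_word_def filter_concat_replace cong: if_cong del: alternating_word.simps)
  also have "pr k (alternating_word (b # bs)) = (if b then [Suc k] else [k, Suc k, k])"
  proof (cases b)
    case True
    then show ?thesis using assms pr_alternating_word_length[of bs b] by (simp del: alternating_word.simps)
  next
    case False
    then have "height bs = 2" using assms by simp
    then show ?thesis using False assms pr_alternating_word_length[of bs b]
      by (simp add: numeral_eq_Suc del: alternating_word.simps)
  qed
  finally show ?thesis by simp
qed

lemma chain_word_split:
  assumes "height bs = 1"
  obtains a c where "alternating_word bs = a @ [length bs] @ c" "chain_word n bs = a @ chain n (length bs) @ c"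
    "set a \<subseteq> {1..<length bs}" "set c \<subseteq> {1..<length bs}"
proof -
  let ?j = "length bs"
  have c1: "count_list (alternating_word bs) ?j = 1" using count_alternating_word assms by simp
  then have "?j \<in> set (alternating_word bs)" by (metis count_list_0_iff one_neq_zero)
  then obtain a c where ac: "alternating_word bs = a @ ?j # c" by (meson split_list)
  then have n: "?j \<notin> set a" "?j \<notin> set c" using c1 by (auto simp: count_list_0_iff)
  have id: "concat (map (\<lambda>x. if x = ?j then w else [x]) u) = u" if "?j \<notin> set u" for u w
    using that by (induction u) auto
  have "chain_word n bs = a @ chain n ?j @ c" unfolding chain_word_def ac using n by (simp add: id)
  moreover have "set a \<subseteq> {1..<?j}" "set c \<subseteq> {1..<?j}"
    using set_alternating_word[of bs] n unfolding ac by (force simp: le_less)+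
  ultimately show ?thesis using that ac by simp
qed

lemma pr_chain_word_above:
  assumes "height bs = 1" "length bs \<le> i" "i < n"
  shows "pr i (chain_word n bs) = chain_pr n i"
proof -
  obtain a c where *: "chain_word n bs = a @ chain n (length bs) @ c"
    "set a \<subseteq> {1..<length bs}" "set c \<subseteq> {1..<length bs}"
    using chain_word_split[OF assms(1), of n] by metis
  have "pr i a = []" "pr i c = []" using * assms(2) by (fastforce simp: filter_empty_conv)+
  then show ?thesis using * pr_chain[OF assms(2,3)] by simp
qed

lemma set_chain_word:
  assumes "height bs = 1" "length bs < n"
  shows "set (chain_word n bs) \<subseteq> {1..n}"
proof -
  obtain a c where *: "chain_word n bs = a @ chain n (length bs) @ c"
    "set a \<subseteq> {1..<length bs}" "set c \<subseteq> {1..<length bs}"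
    using chain_word_split[OF assms(1), of n] by metis
  moreover have "1 \<le> t" if "length bs \<le> t" for t using assms(1) that by (cases bs) auto
  ultimately show ?thesis using assms(2) by (auto simp: chain_def subset_iff)
qed

lemma chain_pr_facts:
  assumes "i < n"
  shows "rev (chain_pr n i) = chain_pr n i" "\<not> sublist [i, i] (chain_pr n i)" "last (chain_pr n i) = i"
  using assms by (auto simp: chain_pr_def sublist_Cons_right)

lemma self_dual_chain_word:
  assumes "height bs = 1" "length bs < n"
  shows "self_dual n (chain_word n bs)"
proof -
  let ?u = "chain_word n bs"
  obtain b cs where bs: "bs = b # cs" using assms(1) by (cases bs) auto
  let ?k = "length cs"
  have pred: "pr ?k ?u = (if b then [Suc ?k, Suc ?k] else [?k, Suc ?k, Suc ?k, ?k])"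
    using pr_chain_word_pred[of cs ?k n b] assms bs by simp
  have "rev (pr i ?u) = pr i ?u \<and> \<not> sublist [i, i] (pr i ?u)" if "i < n" for i
  proof -
    consider "Suc i < length bs" | "i = ?k" | "length bs \<le> i" using bs by force
    then show ?thesis
    proof cases
      case 1
      then show ?thesis
        using pr_chain_word_below[OF assms(2) 1] alternating_word_palindrome[of i bs]
          alternating_word_no_square[of i bs i] by simp
    next
      case 2
      then show ?thesis using pred by (auto simp: sublist_Cons_right)
    next
      case 3
      then show ?thesis using pr_chain_word_above[OF assms(1) 3 that] chain_pr_facts[OF that] by simp
    qed
  qed
  moreover have "\<not> sublist [n, n] (pr (n - 1) ?u)"
    using pr_chain_word_above[OF assms(1), of "n - 1" n] assms(2)
    by (auto simp: chain_pr_def sublist_Cons_right)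
  moreover have "pr (Suc i) ?u = chain_pr n (Suc i)" if i: "Suc i < n" "sublist [Suc i, Suc i] (pr i ?u)" for i
  proof -
    have "\<not> Suc i < length bs"
      using i(2) pr_chain_word_below[OF assms(2), of i] alternating_word_no_square[of i bs "Suc i"] by auto
    then show ?thesis using pr_chain_word_above[OF assms(1) _ i(1)] by simp
  qed
  moreover have "?u \<in> lists {1..n}" using set_chain_word[OF assms] by auto
  ultimately show ?thesis unfolding self_dual_def proper_def by blast
qed

text \<open>A letter above \<open>length bs\<close> is no descent, since the restriction to it and
  its predecessor ends in the predecessor. The letter \<open>length bs\<close> begins and ends the
  chain, so it is followed by a smaller neighbour exactly when this holds before the
  expansion.\<close>

lemma descents_chain_word:
  assumes "height bs = 1" "length bs < n"
  shows "descents (chain_word n bs) = peaks bs"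
proof -
  let ?u = "chain_word n bs" and ?v = "alternating_word bs"
  obtain b cs where bs: "bs = b # cs" using assms(1) by (cases bs) auto
  let ?k = "length cs"
  have len: "length bs = Suc ?k" using bs by simp
  have pred: "pr ?k ?u = (if b then [Suc ?k, Suc ?k] else [?k, Suc ?k, Suc ?k, ?k])"
    using pr_chain_word_pred[of cs ?k n b] assms bs by simp
  have predv: "pr ?k ?v = (if b then [Suc ?k] else [?k, Suc ?k, ?k])"
  proof (cases b)
    case True
    then show ?thesis using assms bs pr_alternating_word_length[of cs b] by (simp del: alternating_word.simps)
  next
    case False
    then have "height cs = 2" using assms bs by simp
    then show ?thesis using False bs pr_alternating_word_length[of cs b]
      by (simp add: numeral_eq_Suc del: alternating_word.simps)
  qed
  have sv: "set ?v \<subseteq> {1..Suc ?k}" using set_alternating_word[of bs] len by simp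
  have "descents ?u = descents ?v"
  proof (intro Set.set_eqI)
    fix s
    consider "s = 0" | "0 < s" "s < ?k" | "0 < s" "s = ?k" | "s = Suc ?k" | "Suc ?k < s" "s \<le> n" | "n < s"
      by linarith
    then show "s \<in> descents ?u \<longleftrightarrow> s \<in> descents ?v"
    proof cases
      case 1
      then show ?thesis using sv set_chain_word[OF assms] by (auto simp: descents_def)
    next
      case 2
      then have "pr (s - 1) ?u = pr (s - 1) ?v" "pr s ?u = pr s ?v"
        using pr_chain_word_below[OF assms(2), of "s - 1"] pr_chain_word_below[OF assms(2), of s] len by simp_all
      then show ?thesis
        unfolding descents_def using in_set_pr(1)[of s ?u] in_set_pr(1)[of s ?v] by auto
    next
      case 3
      then have p: "pr (s - 1) ?u = pr (s - 1) ?v"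
        using pr_chain_word_below[OF assms(2), of "s - 1"] len by simp
      then have "s \<in> set ?u \<longleftrightarrow> s \<in> set ?v"
        using in_set_pr(2)[of "s - 1" ?u] in_set_pr(2)[of "s - 1" ?v] 3 by simp
      moreover have "last (pr s ?u) = s \<longleftrightarrow> last (pr s ?v) = s" using pred predv 3 by simp
      ultimately show ?thesis unfolding descents_def using p by simp
    next
      case 4
      have m: "s \<in> set ?u" "s \<in> set ?v"
      proof -
        have "Suc ?k \<in> set (pr ?k ?u)" "Suc ?k \<in> set (pr ?k ?v)" unfolding pred predv by simp_all
        then show "s \<in> set ?u" "s \<in> set ?v" unfolding in_set_pr 4 .
      qed
      moreover have "last (pr s ?u) = s"
        using pr_chain_word_above[OF assms(1), of s n] chain_pr_facts(3)[of s n] 4 len assms(2) by simp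
      moreover have "last (pr s ?v) = s" using last_pr_top m sv 4 by simp
      moreover have "last (pr (s - 1) ?u) = s \<longleftrightarrow> last (pr (s - 1) ?v) = s"
        using pred predv 4 by simp
      ultimately show ?thesis unfolding descents_def by simp
    next
      case 5
      then have "last (pr (s - 1) ?u) = s - 1"
        using pr_chain_word_above[OF assms(1), of "s - 1" n] chain_pr_facts(3)[of "s - 1" n] len by simp
      then have "last (pr (s - 1) ?u) \<noteq> s" using 5 by linarith
      then have "s \<notin> descents ?u" unfolding descents_def by blast
      moreover have "s \<notin> descents ?v" using 5 sv by (auto simp: descents_def)
      ultimately show ?thesis by simp
    next
      case 6
      then show ?thesis using sv set_chain_word[OF assms] assms(2) len by (auto simp: descents_def)
    qed
  qed
  then show ?thesis using descents_alternating_word by simp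
qed

section \<open>Classification of self-dual words\<close>

lemma alternating_cases:
  assumes "set w \<subseteq> {a, b}" "\<not> sublist [a, a] w" "\<not> sublist [b, b] w"
  obtains k where "w = alt a b k \<or> w = alt b a k"
proof -
  have "\<exists>k. w = alt a b k \<or> w = alt b a k"
    using assms
  proof (induction w)
    case Nil
    then show ?case by (intro exI[of _ 0]) simp
  next
    case (Cons x w)
    then obtain k where k: "w = alt a b k \<or> w = alt b a k" by (auto simp: sublist_Cons_right)
    have x: "x = a \<or> x = b" using Cons.prems by simp
    show ?case
    proof (cases k)
      case 0
      then show ?thesis using k x by (intro exI[of _ 1]) auto
    next
      case (Suc l)
      then have "hd w \<noteq> x" using k Cons.prems x by (auto simp: sublist_Cons_right)
      then have "x # w = alt a b (Suc k) \<or> x # w = alt b a (Suc k)" using k x Suc by auto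
      then show ?thesis by blast
    qed
  qed
  then show ?thesis using that by blast
qed

lemma palindrome_alt:
  assumes "a \<noteq> b" "rev (alt a b k) = alt a b k"
  shows "k = 0 \<or> odd k"
proof (rule ccontr)
  assume "\<not> ?thesis"
  then obtain l where "k = Suc l" "even k" by (cases k) auto
  then show False using assms by (simp add: rev_alt del: rev.simps alt.simps) (simp add: \<open>k = Suc l\<close>)
qed

lemma alternating_palindrome_cases:
  assumes "set w \<subseteq> {a, b}" "\<not> sublist [a, a] w" "\<not> sublist [b, b] w" "rev w = w" "a \<noteq> b"
  obtains "w = []" | c where "w = alt a b (Suc (2 * c))" | c where "w = alt b a (Suc (2 * c))"
proof -
  obtain k where k: "w = alt a b k \<or> w = alt b a k" using alternating_cases assms by metis
  then have "k = 0 \<or> odd k" using palindrome_alt[of a b k] palindrome_alt[of b a k] assms by auto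
  then show ?thesis
  proof
    assume "odd k"
    then obtain c where "k = Suc (2 * c)" by (metis oddE Suc_eq_plus1)
    then show ?thesis using that k by blast
  qed (use k that in auto)
qed

text \<open>The path is rebuilt step by step. Each restriction is a palindrome without squares,
  hence empty or alternating of odd length; its first letter gives the step and the known number of
  \<open>k\<close> its length. The empty restriction belongs to a down-step at height
  \<open>0\<close>.\<close>

lemma self_dual_prefix:
  assumes u: "self_dual n u" and "k \<le> n" "\<And>i. i < k \<Longrightarrow> \<not> sublist [Suc i, Suc i] (pr i u)"
  obtains bs where "length bs = k" "\<And>i. i < k \<Longrightarrow> pr i (alternating_word bs) = pr i u" "count_list u k = height bs"
proof -
  have l: "set u \<subseteq> {1..n}" using u by (auto simp: self_dual_def proper_def)
  have "\<exists>bs. length bs = k \<and> (\<forall>i<k. pr i (alternating_word bs) = pr i u) \<and> count_list u k = height bs"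
    using assms(2,3)
  proof (induction k)
    case 0
    have "0 \<notin> set u" using l by auto
    then show ?case by (intro exI[of _ "[]"]) simp
  next
    case (Suc k)
    have "\<exists>bs. length bs = k \<and> (\<forall>i<k. pr i (alternating_word bs) = pr i u) \<and> count_list u k = height bs"
      by (rule Suc.IH) (use Suc.prems in auto)
    then obtain bs where bs: "length bs = k" "\<forall>i<k. pr i (alternating_word bs) = pr i u" "count_list u k = height bs"
      by blast
    have step: ?case if "pr k (alternating_word (b # bs)) = pr k u" for b
    proof (intro exI[of _ "b # bs"] conjI allI impI)
      show "pr i (alternating_word (b # bs)) = pr i u" if "i < Suc k" for i
        using that \<open>pr k (alternating_word (b # bs)) = pr k u\<close> bs pr_alternating_word_Cons[of i bs b]
        by (cases "i = k") simp_all
      have "count_list u (Suc k) = count_list (alternating_word (b # bs)) (Suc k)"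
        using count_list_pr(2)[of k u] count_list_pr(2)[of k "alternating_word (b # bs)"]
        unfolding \<open>pr k (alternating_word (b # bs)) = pr k u\<close> by simp
      also have "\<dots> = height (b # bs)" using count_alternating_word[of "b # bs"] bs(1) by simp
      finally show "count_list u (Suc k) = height (b # bs)" .
    qed (use bs in simp)
    have cnt: "count_list (pr k u) k = height bs" using bs by simp
    have "set (pr k u) \<subseteq> {k, Suc k}" "\<not> sublist [k, k] (pr k u)" "\<not> sublist [Suc k, Suc k] (pr k u)"
      "rev (pr k u) = pr k u" "k \<noteq> Suc k"
      using u Suc.prems by (auto simp: self_dual_def proper_def)
    then show ?case
    proof (cases rule: alternating_palindrome_cases)
      case 1
      then have "height bs = 0" using cnt by simp
      then show ?thesis
        using step[of False] pr_alternating_word_length[of bs False] bs(1) 1 by (simp del: alternating_word.simps)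
    next
      case (2 c)
      then have "height bs = Suc c" using cnt count_alt_odd(1)[of k "Suc k" c] by (simp del: alt.simps)
      then show ?thesis
        using step[of False] pr_alternating_word_length[of bs False] bs(1) 2 by (simp del: alternating_word.simps)
    next
      case (3 c)
      then have "height bs = c" using cnt count_alt_odd(2)[of "Suc k" k c] by (simp del: alt.simps)
      then show ?thesis
        using step[of True] pr_alternating_word_length[of bs True] bs(1) 3 by (simp del: alternating_word.simps)
    qed
  qed
  then show ?thesis using that by blast
qed

lemma self_dual_cases:
  assumes u: "self_dual n u" and n: "0 < n"
  obtains bs where "length bs = n" "comm_B n u (alternating_word bs)"
  | bs where "length bs < n" "height bs = 1" "comm_B n u (chain_word n bs)"
proof -
  have l: "u \<in> lists {1..n}" using u by (simp add: self_dual_def proper_def)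
  have last: "\<not> sublist [n, n] (pr (n - 1) u)" using u by (simp add: self_dual_def proper_def)
  have peak: "pr (Suc j) u = chain_pr n (Suc j)" if "Suc j < n" "sublist [Suc j, Suc j] (pr j u)" for j
    using u that by (simp add: self_dual_def proper_def)
  show ?thesis
  proof (cases "\<exists>j. Suc j < n \<and> sublist [Suc j, Suc j] (pr j u)")
    case False
    have "\<not> sublist [Suc i, Suc i] (pr i u)" if "i < n" for i
      using that False last by (cases "Suc i = n") auto
    then obtain bs where bs: "length bs = n" "\<And>i. i < n \<Longrightarrow> pr i (alternating_word bs) = pr i u"
      using self_dual_prefix[OF u, of n] by blast
    moreover have "alternating_word bs \<in> lists {1..n}" using set_alternating_word[of bs] bs by auto
    ultimately show ?thesis using that(1)[of bs] comm_B_iff[OF l] by simp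
  next
    case True
    \<comment> \<open>By minimality all restrictions below \<open>k\<close> alternate, so they come
      from a path with \<open>k\<close> steps.\<close>
    define k where "k = (LEAST j. Suc j < n \<and> sublist [Suc j, Suc j] (pr j u))"
    have k: "Suc k < n" "sublist [Suc k, Suc k] (pr k u)"
      using LeastI_ex[OF True] unfolding k_def by auto
    have min: "\<not> sublist [Suc i, Suc i] (pr i u)" if "i < k" for i
      using not_less_Least[of i "\<lambda>j. Suc j < n \<and> sublist [Suc j, Suc j] (pr j u)"] that k unfolding k_def by auto
    obtain cs where cs: "length cs = k" "\<And>i. i < k \<Longrightarrow> pr i (alternating_word cs) = pr i u"
      "count_list u k = height cs"
      using self_dual_prefix[OF u, of k] min k by auto
    \<comment> \<open>Below the last pair, each such restriction contains a square of its larger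
      letter, which forces the next one.\<close>
    have above: "pr i u = chain_pr n i" if "Suc k \<le> i" "i < n" for i
      using that
    proof (induction i rule: dec_induct)
      case base
      then show ?case using peak k by blast
    next
      case (step i)
      then have "pr i u = [i, Suc i, Suc i, i]" by (simp add: chain_pr_def)
      then have "sublist [Suc i, Suc i] (pr i u)" by (simp add: sublist_Cons_right)
      then show ?case using peak step.prems by blast
    qed
    have c2: "count_list (pr k u) (Suc k) = 2"
      using above[of "Suc k"] k count_list_pr(1)[of "Suc k" u] by (auto simp: chain_pr_def split: if_splits)
    obtain x y where xy: "pr k u = x @ [Suc k, Suc k] @ y" using k(2) by (auto simp: sublist_def)
    have pal: "rev (pr k u) = pr k u" and sq: "\<not> sublist [k, k] (pr k u)"
      using u k by (auto simp: self_dual_def proper_def)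
    \<comment> \<open>Applied to the parts before and after the square of \<open>Suc k\<close>;
      being a palindrome then leaves two possibilities for \<open>pr k u\<close>.\<close>
    have small: "w = [] \<or> w = [k]" if w: "set w \<subseteq> {k, Suc k}" "Suc k \<notin> set w" "sublist w (pr k u)" for w
    proof -
      have "w = replicate (length w) k" using w by (intro replicate_eqI) auto
      moreover have "length w \<le> 1"
      proof (rule ccontr)
        assume "\<not> ?thesis"
        then obtain d where "length w = Suc (Suc d)" by (metis Suc_le_D not_less_eq_eq One_nat_def)
        then have "w = [k, k] @ replicate d k" using calculation by simp
        then have "sublist [k, k] w" by simp
        then show False using w(3) sq sublist_order.order.trans by blast
      qed
      ultimately show ?thesis by (cases "length w") auto
    qed
    have n: "Suc k \<notin> set x" "Suc k \<notin> set y" using c2 unfolding xy by (auto simp: count_list_0_iff)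
    have "set (pr k u) \<subseteq> {k, Suc k}" by auto
    then have "set x \<subseteq> {k, Suc k}" "set y \<subseteq> {k, Suc k}" unfolding xy by auto
    moreover have "sublist x (pr k u)" unfolding xy by (rule sublist_append_rightI)
    moreover have "sublist y (pr k u)"
      using sublist_append_leftI[of y "x @ [Suc k, Suc k]"] unfolding xy by simp
    ultimately have "x = [] \<or> x = [k]" "y = [] \<or> y = [k]" using small n by auto
    then have prk: "pr k u = [Suc k, Suc k] \<or> pr k u = [k, Suc k, Suc k, k]" using pal xy by auto
    have cnt: "height cs = count_list (pr k u) k" using cs(3) by simp
    \<comment> \<open>The number of \<open>k\<close> shows that the height after \<open>k\<close>
      steps is \<open>0\<close> or \<open>2\<close>, and \<open>b\<close> is the step that leads to
      height \<open>1\<close>.\<close>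
    obtain b where h: "height (b # cs) = 1" "pr k u = (if b then [Suc k, Suc k] else [k, Suc k, Suc k, k])"
      using prk
    proof
      assume e: "pr k u = [Suc k, Suc k]"
      have "height cs = 0" unfolding cnt e by simp
      then show ?thesis using that[of True] e by simp
    next
      assume e: "pr k u = [k, Suc k, Suc k, k]"
      have "height cs = 2" unfolding cnt e by simp
      then show ?thesis using that[of False] e by simp
    qed
    have len: "length (b # cs) < n" using cs(1) k(1) by simp
    have "pr i (chain_word n (b # cs)) = pr i u" if "i < n" for i
    proof -
      consider "i < k" | "i = k" | "Suc k \<le> i" by linarith
      then show ?thesis
      proof cases
        case 1
        then show ?thesis
          using pr_chain_word_below[OF len, of i] pr_alternating_word_Cons[of i cs b] cs by simp
      next
        case 2
        then show ?thesis using pr_chain_word_pred[OF cs(1) k(1) h(1)] h(2) by simp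
      next
        case 3
        then show ?thesis using pr_chain_word_above[OF h(1) _ that] above[OF 3 that] cs(1) by simp
      qed
    qed
    moreover have "chain_word n (b # cs) \<in> lists {1..n}" using set_chain_word[OF h(1) len] by auto
    ultimately have "comm_B n u (chain_word n (b # cs))" using comm_B_iff[OF l] by simp
    then show ?thesis using that(2) h(1) len by blast
  qed
qed

section \<open>Different paths give different classes\<close>

text \<open>The letter counts are the successive heights of the path, and the two possible steps
  from a given height lead to different heights.\<close>

lemma alternating_word_inj:
  assumes "length bs = length cs" "\<And>i. count_list (alternating_word bs) i = count_list (alternating_word cs) i"
  shows "bs = cs"
  using assms
proof (induction bs cs rule: list_induct2)
  case (Cons b bs c cs)
  have *: "count_list (alternating_word (b # bs)) i = (if i \<le> length bs then count_list (alternating_word bs) i else count_list (alternating_word (b # bs)) i)" for b bs i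
  proof -
    have "filter (\<lambda>x. x \<noteq> Suc (length bs)) (alternating_word (b # bs)) = filter (\<lambda>x. x \<noteq> Suc (length bs)) (alternating_word bs)"
      by (cases b) (simp_all add: filter_insert_next filter_remove1 remove1_idem)
    moreover have "count_list (filter (\<lambda>x. x \<noteq> Suc (length bs)) w) i = count_list w i" if "i \<le> length bs" for w
      using that by (induction w) auto
    ultimately show ?thesis by metis
  qed
  have "count_list (alternating_word bs) i = count_list (alternating_word cs) i" for i
  proof (cases "i \<le> length bs")
    case True
    then show ?thesis using *[of b bs i] *[of c cs i] Cons.hyps Cons.prems[of i] by simp
  next
    case False
    then have "i \<notin> set (alternating_word bs)" "i \<notin> set (alternating_word cs)"
      using set_alternating_word[of bs] set_alternating_word[of cs] Cons.hyps by auto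
    then show ?thesis by simp
  qed
  then have bc: "bs = cs" by (rule Cons.IH)
  have "height (b # bs) = height (c # cs)"
    using count_alternating_word[of "b # bs"] count_alternating_word[of "c # cs"] Cons.hyps Cons.prems
    by (simp del: alternating_word.simps height.simps)
  then have "b = c" using bc by (cases b; cases c) auto
  then show ?case using bc by simp
qed simp

lemma chain_word_square:
  assumes "height bs = 1" "length bs < n"
  shows "sublist [length bs, length bs] (pr (length bs - 1) (chain_word n bs))"
proof -
  obtain b cs where bs: "bs = b # cs" using assms(1) by (cases bs) auto
  then show ?thesis
    using pr_chain_word_pred[of cs "length cs" n b] assms by (auto simp: sublist_Cons_right)
qed

lemma comm_count: "comm_B n u v \<Longrightarrow> count_list u i = count_list v i"
  using pr_comm[of n u v i] count_list_pr(1) by metis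

text \<open>A square of the larger letter appears in the restriction just below
  \<open>length bs\<close> and in none before, which recovers the length. The counts of smaller
  letters are unaffected by the expansion, and the final height is \<open>1\<close> for both
  paths.\<close>

lemma chain_word_inj:
  assumes h: "height bs = 1" "height cs = 1" and l: "length bs < n" "length cs < n"
    and eq: "comm_B n (chain_word n bs) (chain_word n cs)"
  shows "bs = cs"
proof -
  have *: "\<not> length bs < length cs" if h: "height bs = 1" "height cs = 1" and l: "length bs < n" "length cs < n"
    and eq: "\<And>i. pr i (chain_word n bs) = pr i (chain_word n cs)" for bs cs
  proof
    assume lt: "length bs < length cs"
    have "0 < length bs" using h(1) by (cases bs) auto
    then have "pr (length bs - 1) (chain_word n cs) = pr (length bs - 1) (alternating_word cs)"
      using pr_chain_word_below[OF l(2), of "length bs - 1"] lt by simp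
    moreover have "length bs - 1 < length cs" using lt by linarith
    ultimately show False
      using chain_word_square[OF h(1) l(1)] eq alternating_word_no_square[of "length bs - 1" cs "length bs"] lt by simp
  qed
  have len: "length bs = length cs"
    using *[of bs cs] *[of cs bs] h l pr_comm[OF eq] by (metis linorder_neqE_nat)
  have cnt: "count_list (alternating_word bs) i =
      (if i < length bs then count_list (chain_word n bs) i else if i = length bs then 1 else 0)"
    if hb: "height bs = 1" and lb: "length bs < n" for bs i
  proof -
    obtain a c where ac: "alternating_word bs = a @ [length bs] @ c" "chain_word n bs = a @ chain n (length bs) @ c"
      "set a \<subseteq> {1..<length bs}" "set c \<subseteq> {1..<length bs}"
      using chain_word_split[OF hb, of n] by blast
    have "i < length bs \<Longrightarrow> i \<notin> set (chain n (length bs))" using lb by (auto simp: chain_def)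
    moreover have "\<not> i < length bs \<Longrightarrow> i \<notin> set a \<and> i \<notin> set c" using ac by auto
    ultimately show ?thesis using ac by auto
  qed
  show ?thesis
  proof (rule alternating_word_inj[OF len])
    show "count_list (alternating_word bs) i = count_list (alternating_word cs) i" for i
      unfolding cnt[OF h(1) l(1)] cnt[OF h(2) l(2)] len comm_count[OF eq] ..
  qed
qed

lemma alternating_word_neq_chain_word:
  assumes "length bs = n" "height cs = 1" "length cs < n"
  shows "\<not> comm_B n (alternating_word bs) (chain_word n cs)"
proof
  assume "comm_B n (alternating_word bs) (chain_word n cs)"
  moreover have "length cs - 1 < n" using assms(3) by linarith
  ultimately show False
    using chain_word_square[OF assms(2,3)] pr_comm[of n "alternating_word bs" "chain_word n cs" "length cs - 1"]
      alternating_word_no_square[of "length cs - 1" bs "length cs"] assms by simp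
qed

section \<open>Summation over the involutions\<close>

lemma maj_class:
  assumes "B.good n u"
  shows "maj {1..n} (B_matrix n) (cox_class {1..n} (B_matrix n) u) = \<Sum>(descents u)"
  unfolding maj_def B.right_descents_class[OF assms] descents_eq[OF B.good_in_lists[OF assms]] ..

theorem proposition2p5:
  fixes n :: nat
  assumes "n > 0"
  shows "(\<Sum>w \<in> FC_involutions {1..n} (B_matrix n). qvar ^ maj {1..n} (B_matrix n) w) =
    (\<Sum>h=1..n. qvar ^ h * (\<Sum>i=0..h-1. qbinomial qvar (h - 1) i)) + qbinomial qvar n (n div 2)"
proof -
  let ?cls = "cox_class {1..n} (B_matrix n)"
  let ?f = "\<lambda>bs. ?cls (alternating_word bs)" and ?g = "\<lambda>bs. ?cls (chain_word n bs)"
  define L where "L = {bs :: bool list. length bs = n}"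
  define M where "M = {bs. length bs < n \<and> height bs = 1}"
  note inv = good_involution_iff[OF assms]
  have Lf: "B.good n (alternating_word bs)" "comm_B n (alternating_word bs) (rev (alternating_word bs))"
    if "bs \<in> L" for bs
    using inv[of "alternating_word bs"] self_dual_alternating_word[of bs n] that assms by (auto simp: L_def)
  have Mg: "B.good n (chain_word n bs)" "comm_B n (chain_word n bs) (rev (chain_word n bs))"
    if "bs \<in> M" for bs
    using inv[of "chain_word n bs"] self_dual_chain_word[of bs n] that by (auto simp: M_def)
  have FC: "FC_involutions {1..n} (B_matrix n) = ?f ` L \<union> ?g ` M"
  proof (intro Set.set_eqI iffI)
    fix w assume "w \<in> FC_involutions {1..n} (B_matrix n)"
    then obtain u where u: "w = ?cls u" "B.good n u" "comm_B n u (rev u)"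
      using B.FC_involutions_eq by blast
    then have "self_dual n u" using inv by blast
    then show "w \<in> ?f ` L \<union> ?g ` M"
    proof (rule self_dual_cases[OF _ assms])
      fix bs assume bs: "length bs = n" "comm_B n u (alternating_word bs)"
      then have "w = ?f bs" using u B.class_eq_iff[OF u(2) Lf(1)] by (simp add: L_def)
      then show ?thesis using bs by (simp add: L_def)
    next
      fix bs assume bs: "length bs < n" "height bs = 1" "comm_B n u (chain_word n bs)"
      then have "w = ?g bs" using u B.class_eq_iff[OF u(2) Mg(1)] by (simp add: M_def)
      then show ?thesis using bs by (simp add: M_def)
    qed
  next
    fix w assume "w \<in> ?f ` L \<union> ?g ` M"
    then show "w \<in> FC_involutions {1..n} (B_matrix n)"
      unfolding B.FC_involutions_eq using Lf Mg by blast
  qed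
  have disj: "?f ` L \<inter> ?g ` M = {}"
  proof (rule ccontr)
    assume "\<not> ?thesis"
    then obtain bs cs where b: "bs \<in> L" "cs \<in> M" "?f bs = ?g cs" by blast
    then have "comm_B n (alternating_word bs) (chain_word n cs)"
      using B.class_eq_iff[OF Lf(1)[OF b(1)] Mg(1)[OF b(2)]] by simp
    then show False using alternating_word_neq_chain_word b by (simp add: L_def M_def)
  qed
  have injL: "inj_on ?f L"
  proof (rule inj_onI)
    fix bs cs assume b: "bs \<in> L" "cs \<in> L" "?f bs = ?f cs"
    then have "comm_B n (alternating_word bs) (alternating_word cs)"
      using B.class_eq_iff[OF Lf(1)[OF b(1)] Lf(1)[OF b(2)]] by simp
    then show "bs = cs" using b by (intro alternating_word_inj comm_count) (auto simp: L_def)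
  qed
  have injM: "inj_on ?g M"
  proof (rule inj_onI)
    fix bs cs assume b: "bs \<in> M" "cs \<in> M" "?g bs = ?g cs"
    then have "comm_B n (chain_word n bs) (chain_word n cs)"
      using B.class_eq_iff[OF Mg(1)[OF b(1)] Mg(1)[OF b(2)]] by simp
    then show "bs = cs" using b by (intro chain_word_inj) (auto simp: M_def)
  qed
  have finL: "finite L" by (simp add: L_def)
  \<comment> \<open>The lengths start at \<open>1\<close> because the empty path has height
    \<open>0\<close>.\<close>
  have M: "M = (\<Union>j\<in>{1..<n}. {bs. length bs = j \<and> height bs = 1})"
  proof -
    have pos: "1 \<le> length bs" if "height bs = 1" for bs using that by (cases bs) auto
    show ?thesis
    proof (intro Set.set_eqI)
      show "bs \<in> M \<longleftrightarrow> bs \<in> (\<Union>j\<in>{1..<n}. {bs. length bs = j \<and> height bs = 1})" for bs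
        using pos[of bs] unfolding M_def by (cases "height bs = 1") simp_all
    qed
  qed
  have fin: "finite {bs :: bool list. length bs = j \<and> height bs = 1}" for j
    by (rule finite_subset[OF _ finite_lists_length[of j]]) auto
  have finM: "finite M" unfolding M using fin by blast
  let ?q = "\<lambda>w. qvar ^ maj {1..n} (B_matrix n) w"
  have "(\<Sum>w \<in> FC_involutions {1..n} (B_matrix n). ?q w) = (\<Sum>w\<in>?f ` L. ?q w) + (\<Sum>w\<in>?g ` M. ?q w)"
    unfolding FC using finL finM disj by (intro sum.union_disjoint) auto
  also have "(\<Sum>w\<in>?f ` L. ?q w) = (\<Sum>bs\<in>L. qvar ^ \<Sum>(peaks bs))"
    unfolding sum.reindex[OF injL] o_def
    by (rule sum.cong) (simp_all only: maj_class Lf descents_alternating_word)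
  also have "\<dots> = 1 + (\<Sum>h=1..n. qvar ^ h * (\<Sum>i=0..h-1. qbinomial qvar (h - 1) i))"
    unfolding L_def qvar.sum_all_peaks qvar.galois_def ..
  also have "(\<Sum>w\<in>?g ` M. ?q w) = (\<Sum>bs\<in>M. qvar ^ \<Sum>(peaks bs))"
  proof -
    have "?q (?g bs) = qvar ^ \<Sum>(peaks bs)" if "bs \<in> M" for bs
      using maj_class[OF Mg(1)[OF that]] descents_chain_word[of bs n] that unfolding M_def by simp
    then show ?thesis unfolding sum.reindex[OF injM] o_def by (intro sum.cong) simp_all
  qed
  also have "\<dots> = (\<Sum>j=1..<n. qvar.peak_paths_to j 1)"
    unfolding M qvar.peak_paths_to_def using fin by (intro sum.UNION_disjoint) auto
  \<comment> \<open>The sum over \<open>M\<close> is the central \<open>q\<close>-binomial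
    coefficient minus \<open>1\<close>, which cancels the \<open>1\<close> from the path without
    up-steps in \<open>L\<close>.\<close>
  finally show ?thesis
    using qvar.sum_peak_paths_to_1[OF assms] by (simp add: algebra_simps)
qed

end
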